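(* The eigenvector centrality $c(M)$ is a smooth function of $M$. Therefore $\hat M\to M$ in probability implies $\hat c=c(\hat M)\to c$ in probability. Moreover, if $\sqrt g\operatorname{vec}(\hat M-M)$ converges in distribution to $N(0,\Omega)$, then for each node $j\in\{1,\dots,p-1\}$ $$\frac{\hat c_j-c_j}{\sqrt{B_{1j}\Omega B_{1j}^{\mathsf T}/g}}$$ converges in distribution to $N(0,1)$, where $$B_{1j}=\left(R_{I,2}^{-1}\otimes e_j^{\mathsf T}\upsilon_\perp^{\mathsf T}R_J\right)\left[\lambda_1I_{p-1}-\Lambda_J\right]^{-1}\left(R_I^{\mathsf T}\otimes L_J^{\mathsf T}\right).$$
   Context: $M\in\mathbb R^{p\times p}$ is a network adjacency matrix whose leading eigenvalue $\lambda_1$ is real, simple and distinct from all others (Perron–Frobenius). $R=[R_I\ R_J]$ is nonsingular real with $R_I\in\mathbb R^{p\times1}$, $L=[L_I\ L_J]=R^{-\mathsf T}$, and $R^{-1}MR=\begin{bmatrix}\lambda_1&\Lambda_{IJ}\\0&\Lambda_J\end{bmatrix}$, so $MR_I=\lambda_1R_I$. Write $R_I=(R_{I,1}^{\mathsf T},R_{I,2})^{\mathsf T}$ with $R_{I,1}\in\mathbb R^{p-1}$ and scalar $R_{I,2}\ne0$. The eigenvector centrality $c$ is the solution of $Mc=\lambda_1c$ normalized so that the last node is the reference node with unit centrality: $c_j=(R_{I,1}R_{I,2}^{-1})_j$ for $j\le p-1$ and $c_p=1$. With $D^{\mathsf T}=R_{I,1}R_{I,2}^{-1}$, $\upsilon_\perp^{\mathsf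 T}=[\,I_{p-1}\ \ -D^{\mathsf T}\,]$. $e_j\in\mathbb R^{p-1}$ is the $j$th standard basis vector. $\Omega\in\mathbb R^{p^2\times p^2}$ is positive definite, $\hat M$ is an estimator of $M$, and $g\in\{n,T\}$ denotes the sample size. *)

theory Defs
  imports "HOL-Probability.Probability" "HOL-Computational_Algebra.Polynomial"
begin

section \<open>Leading eigenvalues\<close>

definition eigenvalue :: "'a::field^'n^'n \<Rightarrow> 'a \<Rightarrow> bool" where
  "eigenvalue A \<mu> \<longleftrightarrow> (\<exists>v. v \<noteq> 0 \<and> A *v v = \<mu> *s v)"

definition charpoly :: "'a::comm_ring_1^'n^'n \<Rightarrow> 'a poly" where
  "charpoly A = det (mat [:0, 1:] - (\<chi> i j. [:A $ i $ j:]))"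

definition complexify :: "real^'n^'m \<Rightarrow> complex^'n^'m" where
  "complexify A = (\<chi> i j. complex_of_real (A $ i $ j))"

text \<open>The real number \<open>l\<close> is the leading eigenvalue of the real matrix \<open>A\<close>: it is the unique
  eigenvalue with the largest real part, among all complex eigenvalues. Ordering by real part rather
  than by modulus only matters for matrices with negative entries or for imprimitive (for instance
  bipartite) networks. For the latter the Perron root is simple but shares its modulus with other
  eigenvalues, so that selection by modulus is unstable under perturbations; lemma
  \<open>leading_eigenvalueI_spectral_radius\<close> shows that the Perron root is always covered.\<close>

definition leading_eigenvalue :: "real^'n^'n \<Rightarrow> real \<Rightarrow> bool" where
  "leading_eigenvalue A l \<longleftrightarrow>
     eigenvalue (complexify A) (complex_of_real l) \<and>
     (\<forall>\<mu>. eigenvalue (complexify A) \<mu> \<and> \<mu> \<noteq> complex_of_real l \<longrightarrow> Re \<mu> < l)"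

definition simple_eigenvalue :: "real^'n^'n \<Rightarrow> real \<Rightarrow> bool" where
  "simple_eigenvalue A l \<longleftrightarrow> order (complex_of_real l) (charpoly (complexify A)) = 1"

lemma leading_eigenvalueI_spectral_radius:
  assumes "eigenvalue (complexify A) (complex_of_real l)"
    and "\<And>\<mu>. eigenvalue (complexify A) \<mu> \<Longrightarrow> cmod \<mu> \<le> l"
  shows "leading_eigenvalue A l"
  unfolding leading_eigenvalue_def
proof (intro conjI allI impI)
  fix \<mu> assume \<mu>: "eigenvalue (complexify A) \<mu> \<and> \<mu> \<noteq> complex_of_real l"
  then have le: "cmod \<mu> \<le> l" using assms(2) by blast
  show "Re \<mu> < l"
  proof (rule ccontr)
    assume "\<not> Re \<mu> < l"
    with le complex_Re_le_cmod[of \<mu>] have *: "Re \<mu> = l" "cmod \<mu> = l" by linarith+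
    then have "Im \<mu> = 0" using cmod_power2[of \<mu>] by simp
    with *(1) have "\<mu> = complex_of_real l" by (simp add: complex_eq_iff)
    with \<mu> show False by simp
  qed
qed (fact assms(1))

section \<open>Eigenvector centrality\<close>

text \<open>The \<open>p\<close> nodes are indexed by the type \<open>'n option\<close>, where \<open>p = CARD('n) + 1\<close>: the nodes
  \<open>1, \<dots>, p - 1\<close> are the \<open>Some j\<close>, and \<open>None\<close> is the last node, i.e. the reference node.\<close>

definition is_centrality :: "real^('n::finite option)^('n option) \<Rightarrow> real^('n option) \<Rightarrow> bool" where
  "is_centrality A c \<longleftrightarrow>
     (\<exists>l. leading_eigenvalue A l \<and> simple_eigenvalue A l \<and> A *v c = l *s c) \<and> c $ None = 1"

definition centrality_domain :: "(real^('n::finite option)^('n option)) set" where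
  "centrality_domain = {A. \<exists>c. is_centrality A c}"

text \<open>An estimate of a matrix in the domain may fall outside the domain. There the centrality is
  set to the arbitrary value \<open>0\<close>.\<close>

definition centrality :: "real^('n::finite option)^('n option) \<Rightarrow> real^('n option)" where
  "centrality A = (if A \<in> centrality_domain then THE c. is_centrality A c else 0)"

section \<open>Smooth functions\<close>

text \<open>\<open>C_k k S f\<close>, for open \<open>S\<close> in a finite-dimensional space: \<open>f\<close> is \<open>k\<close> times continuously
  differentiable on \<open>S\<close>. All directional derivatives are required to be of class \<open>k - 1\<close>.\<close>

fun C_k :: "nat \<Rightarrow> 'a::real_normed_vector set \<Rightarrow> ('a \<Rightarrow> 'b::real_normed_vector) \<Rightarrow> bool" where
  "C_k 0 S f \<longleftrightarrow> continuous_on S f"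
| "C_k (Suc k) S f \<longleftrightarrow> (\<forall>x\<in>S. f differentiable (at x)) \<and>
     (\<forall>v. C_k k S (\<lambda>x. frechet_derivative f (at x) v))"

definition smooth_on :: "'a::real_normed_vector set \<Rightarrow> ('a \<Rightarrow> 'b::real_normed_vector) \<Rightarrow> bool" where
  "smooth_on S f \<longleftrightarrow> (\<forall>k. C_k k S f)"

section \<open>Stochastic convergence and the multivariate normal distribution\<close>

text \<open>The random elements \<open>X g\<close> may live on different probability spaces \<open>P g\<close>.\<close>

definition converges_in_probability ::
    "(nat \<Rightarrow> 'w measure) \<Rightarrow> (nat \<Rightarrow> 'w \<Rightarrow> 'b::metric_space) \<Rightarrow> 'b \<Rightarrow> bool" where
  "converges_in_probability P X x \<longleftrightarrow>
     (\<forall>g. X g \<in> borel_measurable (P g)) \<and>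
     (\<forall>\<epsilon>>0. (\<lambda>g. measure (P g) {\<omega> \<in> space (P g). dist (X g \<omega>) x > \<epsilon>}) \<longlonglongrightarrow> 0)"

definition converges_in_distribution ::
    "(nat \<Rightarrow> 'w measure) \<Rightarrow> (nat \<Rightarrow> 'w \<Rightarrow> 'b::metric_space) \<Rightarrow> 'b measure \<Rightarrow> bool" where
  "converges_in_distribution P X N \<longleftrightarrow>
     (\<forall>g. X g \<in> borel_measurable (P g)) \<and>
     (\<forall>f :: 'b \<Rightarrow> real. continuous_on UNIV f \<and> bounded (range f) \<longrightarrow>
        (\<lambda>g. \<integral>\<omega>. f (X g \<omega>) \<partial>(P g)) \<longlonglongrightarrow> (\<integral>x. f x \<partial>N))"

definition positive_definite :: "real^'k^'k \<Rightarrow> bool" where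
  "positive_definite S \<longleftrightarrow> transpose S = S \<and> (\<forall>x. x \<noteq> 0 \<longrightarrow> x \<bullet> (S *v x) > 0)"

definition mv_normal :: "real^'k \<Rightarrow> real^'k^'k \<Rightarrow> (real^'k) measure" where
  "mv_normal m S = density lborel (\<lambda>x. ennreal
     (exp (- ((x - m) \<bullet> (matrix_inv S *v (x - m))) / 2) / sqrt ((2 * pi) ^ CARD('k) * det S)))"

section \<open>Vectorisation, Kronecker product and block matrices\<close>

text \<open>Column-stacking: a pair index consists of the column (slow) and the row (fast), so that
  \<open>vectorise (A ** X ** C) = kron (transpose C) A *v vectorise X\<close>.\<close>

definition vectorise :: "'a^'n^'m \<Rightarrow> 'a^('n \<times> 'm)" where
  "vectorise A = (\<chi> q. A $ snd q $ fst q)"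

definition kron :: "'a::times^'b^'c \<Rightarrow> 'a^'d^'e \<Rightarrow> 'a^('b \<times> 'd)^('c \<times> 'e)" where
  "kron A B = (\<chi> r q. A $ fst r $ fst q * B $ snd r $ snd q)"

text \<open>As an index of a block \<open>I\<close>/\<open>J\<close>, \<open>None\<close> stands for the one-dimensional block \<open>I\<close> and the
  \<open>Some k\<close> make up the block \<open>J\<close>. In this role \<open>None\<close> comes first.\<close>

definition I_block :: "'a^('n::finite option)^'m \<Rightarrow> 'a^'m" where
  "I_block A = column None A"

definition J_block :: "'a^('n::finite option)^'m \<Rightarrow> 'a^'n^'m" where
  "J_block A = (\<chi> i k. A $ i $ Some k)"

definition block_triangular :: "real \<Rightarrow> real^'n \<Rightarrow> real^'n^'n \<Rightarrow> real^('n::finite option)^('n option)" where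
  "block_triangular a b C = (\<chi> r q.
     (case r of
        None \<Rightarrow> (case q of None \<Rightarrow> a | Some l \<Rightarrow> b $ l)
      | Some k \<Rightarrow> (case q of None \<Rightarrow> 0 | Some l \<Rightarrow> C $ k $ l)))"

text \<open>The \<open>(p - 1) \<times> p\<close> matrix \<open>[I, -R_I1 / R_I2]\<close>.\<close>

definition v_perp_T :: "real^('n::finite option) \<Rightarrow> real^('n option)^'n" where
  "v_perp_T RI = (\<chi> i q. case q of Some l \<Rightarrow> (if i = l then 1 else 0)
                             | None \<Rightarrow> - (RI $ Some i / RI $ None))"

text \<open>The \<open>1 \<times> p\<^sup>2\<close> row \<open>B_1j\<close>; \<open>RI\<close> and \<open>RJ\<close> are the blocks of \<open>R\<close>, and \<open>LJ\<close> is a block of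
  \<open>L\<close>, the inverse of the transpose of \<open>R\<close>. The one-by-one factor \<open>mat 1\<close> of the middle Kronecker
  product only converts the index type \<open>'n\<close> into \<open>1 \<times> 'n\<close>.\<close>

definition B_row ::
    "real \<Rightarrow> real^('n::finite option)^('n option) \<Rightarrow> real^'n^'n \<Rightarrow> 'n \<Rightarrow>
     real^('n option \<times> 'n option)^(1 \<times> 1)" where
  "B_row l R \<Lambda>J j =
     (let RI = I_block R; RJ = J_block R; LJ = J_block (transpose (matrix_inv R)) in
        kron (mat (inverse (RI $ None)) :: real^1^1)
             (rowvector (axis j 1) ** v_perp_T RI ** RJ :: real^'n^1)
        ** kron (mat 1 :: real^1^1) (matrix_inv (mat l - \<Lambda>J))
        ** kron (rowvector RI :: real^('n option)^1) (transpose LJ))"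

end

theory Submission
  imports Defs
begin

text \<open>
  The centrality \<open>c\<close> and the leading eigenvalue \<open>l\<close> of \<open>A\<close> solve \<open>(l - A) c = 0\<close>, \<open>c_None = 1\<close>.
  The key object is the \<^emph>\<open>bordered matrix\<close>: \<open>l - A\<close> with the column of the reference node
  replaced by \<open>c\<close>. Column operations turn \<open>det (z - A)\<close> into \<open>z - l\<close> times the determinant of
  \<open>z - A\<close> bordered by \<open>c\<close>, so \<open>l\<close> is algebraically simple exactly if the bordered matrix is
  invertible (\<open>order_charpoly_eq_1_iff\<close>). Nearby eigenvectors, eigenvalues and their
  differences solve linear systems with nearby bordered matrices, and Cramer's rule then takes
  the place of the implicit function theorem and of Rouche's theorem.

  \<^item> \<^emph>\<open>The domain is open.\<close> The characteristic polynomial changes sign at a simple real root, so a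
    nearby matrix \<open>B\<close> has a real eigenvalue near \<open>l\<close>; it is the only eigenvalue of \<open>B\<close> there
    (\<open>simple_eigenvalue_locally_unique\<close>). Eigenvalues of \<open>B\<close> are bounded, so by compactness none
    of the others can have a real part as large (\<open>leading_eigenvalue_perturbation\<close>).

  \<^item> \<^emph>\<open>Smoothness.\<close> For \<open>A\<close> and \<open>B\<close> in the domain the difference of the two eigenpairs solves
    exactly, without remainder, a bordered system with right-hand side \<open>(B - A) c_B\<close>
    (\<open>eigenpair_difference\<close>). Inverting it exhibits the difference as a continuous matrix applied
    to \<open>B - A\<close>, which is differentiability. The derivative is rational in \<open>A\<close>, \<open>l\<close> and \<open>c\<close>, so
    every degree of smoothness of \<open>(c, l)\<close> yields the next one (\<open>C_k_eigenpair\<close>).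

  \<^item> \<^emph>\<open>Asymptotics.\<close> Consistency is the continuous mapping theorem. For normality, the delta method
    replaces \<open>sqrt g (c_j(Mhat) - c_j(M))\<close> by the derivative of \<open>c_j\<close> at the normal limit, and a linear
    functional \<open>b\<close> of \<open>N(0, \<Omega>)\<close> has the law \<open>N(0, b \<Omega> b\<^sup>T)\<close>: substitute an \<open>\<Omega>\<close>-orthonormal basis
    that contains the normalised \<open>b\<close> (\<open>distr_mv_normal_linear_functional\<close>).

  \<^item> \<^emph>\<open>The derivative is \<open>B_1j\<close>.\<close> Differentiate \<open>(l - M) c = 0\<close> in direction \<open>H\<close> and multiply by
    \<open>L_J\<^sup>T\<close>. This kills \<open>c\<close> and intertwines \<open>M\<close> with \<open>\<Lambda>_J\<close>, so \<open>(l - \<Lambda>_J) L_J\<^sup>T dc = L_J\<^sup>T H c\<close>. Then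
    \<open>\<upsilon>\<^sup>T R_J\<close> recovers the entries of \<open>dc\<close>, as \<open>\<upsilon>\<^sup>T R_I = 0\<close> and \<open>dc_None = 0\<close>.
\<close>

section \<open>Simple eigenvalues and bordered matrices\<close>

definition replace_column :: "'n \<Rightarrow> 'a^'m \<Rightarrow> 'a^'n^'m \<Rightarrow> 'a^'n^'m" where
  "replace_column k v X = (\<chi> i j. if j = k then v $ i else X $ i $ j)"

text \<open>Bordered matrices act on a vector without \<open>k\<close>-th entry together with a scalar. Both are stored
  in one vector \<open>x\<close>, whose entry \<open>k\<close> is the scalar.\<close>

lemma replace_column_mult:
  fixes X :: "'a::comm_ring_1^'n^'m"
  shows "replace_column k v X *v x = X *v (\<chi> j. if j = k then 0 else x $ j) + x $ k *s v"
proof -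
  have "(\<Sum>j\<in>UNIV. (if j = k then v $ i else X $ i $ j) * x $ j)
      = (\<Sum>j\<in>UNIV. X $ i $ j * (if j = k then 0 else x $ j) + (if j = k then x $ k * v $ i else 0))"
    for i by (intro sum.cong) auto
  then show ?thesis
    by (simp add: replace_column_def matrix_vector_mult_def vec_eq_iff sum.distrib)
qed

lemma det_replace_column_mult:
  fixes X :: "'a::field^'n^'n"
  shows "det (replace_column k (X *v x) X) = x $ k * det X"
  using cramer_lemma[of k X x] by (simp add: replace_column_def)

lemma det_replace_column_scale:
  fixes X :: "'a::comm_ring_1^'n^'n"
  shows "det (replace_column k (c *s v) X) = c * det (replace_column k v X)"
proof -
  have *: "transpose (replace_column k u X) = (\<chi> j. if j = k then u else (\<chi> i. X $ i $ j))" for u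
    by (simp add: replace_column_def transpose_def vec_eq_iff)
  have "det (transpose (replace_column k (c *s v) X)) = c * det (transpose (replace_column k v X))"
    unfolding * by (rule det_row_mul)
  then show ?thesis by simp
qed

lemma solution_eq_cramer:
  fixes X :: "'a::field^'n^'n"
  assumes "det X \<noteq> 0" "X *v x = b"
  shows "x $ k = det (replace_column k b X) / det X"
  using cramer[OF assms(1), of x b] assms(2) by (simp add: replace_column_def)

lemma mat_minus_mult: "(mat l - A) *v x = l *s x - A *v x"
  for A :: "'a::comm_ring_1^'n^'n"
proof -
  have "(\<Sum>j\<in>UNIV. (if i = j then l else 0) * x $ j) = (\<Sum>j\<in>UNIV. if i = j then l * x $ j else 0)" for i
    by (rule sum.cong) auto
  then show ?thesis
    by (simp add: matrix_vector_mult_diff_rdistrib mat_def matrix_vector_mult_def vec_eq_iff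
        left_diff_distrib sum_subtractf)
qed

lemma det_zero_iff_kernel:
  fixes X :: "'a::field^'n^'n"
  shows "det X = 0 \<longleftrightarrow> (\<exists>x. x \<noteq> 0 \<and> X *v x = 0)"
  using invertible_det_nz[of X] matrix_left_invertible_ker[of X] invertible_left_inverse[of X] by blast

lemma eigenvalue_iff_det:
  fixes A :: "'a::field^'n^'n"
  shows "eigenvalue A z \<longleftrightarrow> det (mat z - A) = 0"
  unfolding det_zero_iff_kernel eigenvalue_def by (auto simp: mat_minus_mult)

lemma poly_det:
  fixes X :: "'a::comm_ring_1 poly^'n^'n"
  shows "poly (det X) z = det (\<chi> i j. poly (X $ i $ j) z)"
proof -
  have "poly (of_int m) z = of_int m" for m
    by (cases m rule: int_cases2) auto
  then show ?thesis
    by (simp add: det_def poly_sum poly_prod)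
qed

lemma poly_charpoly: "poly (charpoly A) z = det (mat z - A)"
  unfolding charpoly_def poly_det
  by (rule arg_cong[where f = det]) (simp add: vec_eq_iff mat_def)

lemma norm_eigenvalue_le:
  fixes A :: "complex^'n^'n"
  assumes "A *v x = z *s x" "x \<noteq> 0"
  shows "norm z \<le> (\<Sum>i\<in>UNIV. \<Sum>j\<in>UNIV. norm (A $ i $ j))"
proof -
  obtain i where i: "\<And>j. norm (x $ j) \<le> norm (x $ i)"
    using Max_in[of "range (\<lambda>j. norm (x $ j))"] Max_ge[of "range (\<lambda>j. norm (x $ j))"] by fastforce
  have "x $ i \<noteq> 0"
    using i assms(2) by (force simp: vec_eq_iff)
  have "z * x $ i = (\<Sum>j\<in>UNIV. A $ i $ j * x $ j)"
    using arg_cong[OF assms(1), of "\<lambda>v. v $ i"] by (simp add: matrix_vector_mult_def)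
  then have "norm z * norm (x $ i) \<le> (\<Sum>j\<in>UNIV. norm (A $ i $ j) * norm (x $ j))"
    using norm_sum[of "\<lambda>j. A $ i $ j * x $ j" UNIV] by (simp add: norm_mult flip: norm_mult)
  also have "\<dots> \<le> (\<Sum>j\<in>UNIV. norm (A $ i $ j) * norm (x $ i))"
    by (intro sum_mono mult_left_mono i) auto
  also have "\<dots> = (\<Sum>j\<in>UNIV. norm (A $ i $ j)) * norm (x $ i)"
    by (simp add: sum_distrib_right)
  finally have "norm z \<le> (\<Sum>j\<in>UNIV. norm (A $ i $ j))"
    using \<open>x $ i \<noteq> 0\<close> by simp
  also have "\<dots> \<le> (\<Sum>i\<in>UNIV. \<Sum>j\<in>UNIV. norm (A $ i $ j))"
    by (rule member_le_sum) (auto intro: sum_nonneg)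
  finally show ?thesis .
qed

text \<open>The zero polynomial would make every number an eigenvalue, but eigenvalues are bounded. This is
  what makes the multiplicity of a root of the characteristic polynomial meaningful.\<close>

lemma charpoly_nonzero: "charpoly A \<noteq> 0" for A :: "complex^'n^'n"
proof
  let ?C = "(\<Sum>i\<in>UNIV. \<Sum>j\<in>UNIV. norm (A $ i $ j))"
  assume "charpoly A = 0"
  then have "eigenvalue A (of_real (?C + 1))"
    by (simp add: eigenvalue_iff_det flip: poly_charpoly)
  then have "norm (of_real (?C + 1) :: complex) \<le> ?C"
    unfolding eigenvalue_def using norm_eigenvalue_le by blast
  then show False by (simp del: of_real_add of_real_sum)
qed

text \<open>By Cramer's rule, \<open>v $ k = 1\<close> times the determinant of \<open>z - A\<close> is the determinant after replacing
  column \<open>k\<close> by \<open>(z - A) v = (z - l) v\<close>.\<close>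

lemma det_mat_minus_factor:
  fixes A :: "'a::field^'n^'n"
  assumes "A *v v = l *s v" "v $ k = 1"
  shows "det (mat z - A) = (z - l) * det (replace_column k v (mat z - A))"
proof -
  have "(mat z - A) *v v = (z - l) *s v"
    by (simp add: mat_minus_mult assms(1) vector_sub_rdistrib)
  then show ?thesis
    using det_replace_column_mult[of k "mat z - A" v] assms(2)
    by (simp only: det_replace_column_scale mult_1)
qed

text \<open>The factor \<open>z - l\<close> splits off the characteristic polynomial, and the multiplicity is 1 if and only
  if the cofactor, a bordered determinant, does not vanish at \<open>l\<close> as well.\<close>

lemma order_charpoly_eq_1_iff:
  fixes A :: "complex^'n^'n"
  assumes v: "A *v v = l *s v" "v $ k = 1"
  shows "order l (charpoly A) = 1 \<longleftrightarrow> det (replace_column k v (mat l - A)) \<noteq> 0"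
proof -
  define h where "h = det (replace_column k (\<chi> i. [:v $ i:]) (mat [:0, 1:] - (\<chi> i j. [:A $ i $ j:])))"
  have h: "poly h z = det (replace_column k v (mat z - A))" for z
    unfolding h_def poly_det
    by (rule arg_cong[where f = det]) (simp add: vec_eq_iff mat_def replace_column_def)
  have "poly (charpoly A) z = poly ([:- l, 1:] * h) z" for z
    unfolding poly_charpoly det_mat_minus_factor[OF v] by (simp add: h left_diff_distrib)
  then have eq: "charpoly A = [:- l, 1:] * h"
    by (metis ext poly_eq_poly_eq_iff)
  have "order l (charpoly A) = order l [:- l, 1:] + order l h"
    using charpoly_nonzero[of A] unfolding eq by (rule order_mult)
  also have "order l [:- l, 1:] = 1"
    using order_power_n_n[of l 1] by simp
  finally show ?thesis
    using order_root[of h l] charpoly_nonzero[of A] eq by (auto simp flip: h)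
qed

lemma det_of_real: "det (\<chi> i j. of_real (X $ i $ j)) = of_real (det X)"
  by (simp add: det_def)

lemma det_mat_minus_complexify:
  "det (mat (of_real x) - complexify A) = of_real (det (mat x - A))"
  unfolding det_of_real[symmetric] complexify_def
  by (rule arg_cong[where f = det]) (simp add: vec_eq_iff mat_def)

text \<open>Multiplicities are counted over the complex numbers, but for a real eigenpair the bordered matrix
  is real, and so is its determinant.\<close>

lemma simple_eigenvalue_iff:
  fixes A :: "real^'n^'n"
  assumes "A *v v = l *s v" "v $ k = 1"
  shows "simple_eigenvalue A l \<longleftrightarrow> det (replace_column k v (mat l - A)) \<noteq> 0"
proof -
  define w :: "complex^'n" where "w = (\<chi> i. of_real (v $ i))"
  have w: "complexify A *v w = of_real l *s w" "w $ k = 1"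
    using assms unfolding vec_eq_iff
    by (simp_all add: w_def complexify_def matrix_vector_mult_def flip: of_real_mult of_real_sum)
  have "replace_column k w (mat (of_real l) - complexify A)
      = (\<chi> i j. of_real (replace_column k v (mat l - A) $ i $ j))"
    by (simp add: vec_eq_iff mat_def replace_column_def complexify_def w_def)
  then show ?thesis
    unfolding simple_eigenvalue_def order_charpoly_eq_1_iff[OF w] by (simp add: det_of_real)
qed

section \<open>Perturbation of a simple eigenpair\<close>

lemma tendsto_det:
  fixes X :: "'b \<Rightarrow> 'a::real_normed_field^'n^'n"
  assumes "(X \<longlongrightarrow> Y) F"
  shows "((\<lambda>t. det (X t)) \<longlongrightarrow> det Y) F"
  unfolding det_def by (intro tendsto_intros tendsto_vec_nth assms)

lemma tendsto_mat_minus: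
  fixes B :: "'b \<Rightarrow> 'a::real_normed_field^'n^'n"
  assumes "(B \<longlongrightarrow> A) F" "(z \<longlongrightarrow> l) F"
  shows "((\<lambda>t. mat (z t) - B t) \<longlongrightarrow> mat l - A) F"
proof (intro tendsto_diff assms vec_tendstoI)
  show "((\<lambda>t. mat (z t) $ i $ j :: 'a) \<longlongrightarrow> mat l $ i $ j) F" for i j :: 'n
    using assms(2) by (cases "i = j") (simp_all add: mat_def)
qed

lemma tendsto_replace_column:
  fixes X :: "'b \<Rightarrow> 'a::topological_space^'n^'m"
  assumes "(v \<longlongrightarrow> w) F" "(X \<longlongrightarrow> Y) F"
  shows "((\<lambda>t. replace_column k (v t) (X t)) \<longlongrightarrow> replace_column k w Y) F"
proof (intro vec_tendstoI)
  show "((\<lambda>t. replace_column k (v t) (X t) $ i $ j) \<longlongrightarrow> replace_column k w Y $ i $ j) F" for i j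
    by (cases "j = k") (simp_all add: replace_column_def tendsto_vec_nth assms)
qed

lemma tendsto_column:
  fixes X :: "'b \<Rightarrow> 'a::topological_space^'n^'m"
  assumes "(X \<longlongrightarrow> Y) F"
  shows "((\<lambda>t. column k (X t)) \<longlongrightarrow> column k Y) F"
  by (intro vec_tendstoI) (simp add: column_def tendsto_vec_nth assms)

lemma matrix_vector_mult_axis: "X *v axis k 1 = column k X" for X :: "'a::comm_ring_1^'n^'m"
  by (simp add: matrix_vector_mult_def column_def axis_def vec_eq_iff if_distrib cong: if_cong)

lemma column_matrix_mult: "column k (A ** B) = A *v column k B"
  by (simp add: column_def matrix_matrix_mult_def matrix_vector_mult_def)

text \<open>A normalised kernel vector of \<open>X\<close> is a rational function of \<open>X\<close>, with a fixed vector \<open>v\<close> as border.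
  Applied to \<open>X = z - B\<close> this makes eigenvectors depend continuously on \<open>B\<close> and \<open>z\<close>.\<close>

lemma kernel_vector_cramer:
  fixes X :: "'a::field^'n^'n"
  assumes "X *v x = 0" "x $ k = 1" "det (replace_column k v X) \<noteq> 0" "i \<noteq> k"
  shows "x $ i = det (replace_column i (- column k X) (replace_column k v X)) / det (replace_column k v X)"
proof -
  define y where "y = (\<chi> j. if j = k then 0 else x $ j)"
  have "x = y + axis k 1"
    using assms(2) by (simp add: y_def vec_eq_iff axis_def)
  then have "X *v y + column k X = 0"
    using assms(1) by (metis matrix_vector_mult_axis matrix_vector_right_distrib)
  moreover have "replace_column k v X *v y = X *v y"
  proof -
    have "(\<chi> j. if j = k then 0 else y $ j) = y" "y $ k = 0"
      by (simp_all add: y_def vec_eq_iff)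
    then show ?thesis by (simp add: replace_column_mult)
  qed
  ultimately have "replace_column k v X *v y = - column k X"
    by (simp add: eq_neg_iff_add_eq_0)
  from solution_eq_cramer[OF assms(3) this, of i] show ?thesis
    using assms(4) by (simp add: y_def)
qed

text \<open>An eigenvector of \<open>B\<close> whose entry \<open>k\<close> vanishes is in the kernel of \<open>z - B\<close> bordered by any vector,
  and this matrix is invertible near a simple eigenpair.\<close>

lemma eventually_eigenvector_nth_nonzero:
  fixes B :: "'b \<Rightarrow> 'a::real_normed_field^'n^'n"
  assumes B: "(B \<longlongrightarrow> A) F" and z: "(z \<longlongrightarrow> l) F"
    and nz: "det (replace_column k v (mat l - A)) \<noteq> 0"
  shows "\<forall>\<^sub>F t in F. \<forall>x. x \<noteq> 0 \<and> B t *v x = z t *s x \<longrightarrow> x $ k \<noteq> 0"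
proof -
  have "((\<lambda>t. det (replace_column k v (mat (z t) - B t))) \<longlongrightarrow> det (replace_column k v (mat l - A))) F"
    by (intro tendsto_det tendsto_replace_column tendsto_const tendsto_mat_minus B z)
  then have "\<forall>\<^sub>F t in F. det (replace_column k v (mat (z t) - B t)) \<noteq> 0"
    using nz by (rule tendsto_imp_eventually_ne)
  then show ?thesis
  proof eventually_elim
    case (elim t)
    show ?case
    proof (intro allI impI notI, elim conjE)
      fix x assume x: "x \<noteq> 0" "B t *v x = z t *s x" "x $ k = 0"
      have "(\<chi> j. if j = k then 0 else x $ j) = x"
        using x(3) by (simp add: vec_eq_iff)
      then have "replace_column k v (mat (z t) - B t) *v x = 0"
        by (simp add: replace_column_mult mat_minus_mult x(2,3))
      with x(1) elim show False by (auto simp: det_zero_iff_kernel)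
    qed
  qed
qed

lemma eigenvector_tendsto:
  fixes B :: "'b \<Rightarrow> 'a::real_normed_field^'n^'n"
  assumes B: "(B \<longlongrightarrow> A) F" and z: "(z \<longlongrightarrow> l) F"
    and v: "A *v v = l *s v" "v $ k = 1"
    and nz: "det (replace_column k v (mat l - A)) \<noteq> 0"
    and x: "\<forall>\<^sub>F t in F. B t *v x t = z t *s x t \<and> x t $ k = 1"
  shows "(x \<longlongrightarrow> v) F"
proof (rule vec_tendstoI)
  fix i
  define q where "q X = det (replace_column i (- column k X) (replace_column k v X)) / det (replace_column k v X)"
    for X :: "'a^'n^'n"
  have lim: "((\<lambda>t. det (replace_column k v (mat (z t) - B t))) \<longlongrightarrow> det (replace_column k v (mat l - A))) F"
    by (intro tendsto_det tendsto_replace_column tendsto_const tendsto_mat_minus B z)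
  show "((\<lambda>t. x t $ i) \<longlongrightarrow> v $ i) F"
  proof (cases "i = k")
    case True
    show ?thesis
      unfolding True v(2) by (rule tendsto_eventually) (use x in \<open>auto elim: eventually_mono\<close>)
  next
    case False
    have "\<forall>\<^sub>F t in F. x t $ i = q (mat (z t) - B t)"
      using x tendsto_imp_eventually_ne[OF lim nz]
      by eventually_elim (use False in \<open>auto simp: q_def mat_minus_mult intro!: kernel_vector_cramer\<close>)
    moreover have "v $ i = q (mat l - A)"
      unfolding q_def using v nz False by (intro kernel_vector_cramer) (auto simp: mat_minus_mult)
    moreover have "((\<lambda>t. q (mat (z t) - B t)) \<longlongrightarrow> q (mat l - A)) F"
      unfolding q_def
      by (intro tendsto_divide nz tendsto_det tendsto_replace_column tendsto_const tendsto_minus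
          tendsto_column tendsto_mat_minus B z)
    ultimately show ?thesis
      by (simp add: tendsto_cong)
  qed
qed

lemma eventually_eigenvector_normalized:
  fixes B :: "'b \<Rightarrow> 'a::real_normed_field^'n^'n"
  assumes B: "(B \<longlongrightarrow> A) F" and z: "(z \<longlongrightarrow> l) F"
    and nz: "det (replace_column k v (mat l - A)) \<noteq> 0"
    and ev: "\<forall>\<^sub>F t in F. eigenvalue (B t) (z t)"
  obtains x where "\<forall>\<^sub>F t in F. B t *v x t = z t *s x t \<and> x t $ k = 1"
proof -
  have "\<forall>\<^sub>F t in F. \<exists>x. B t *v x = z t *s x \<and> x $ k = 1"
    using eventually_eigenvector_nth_nonzero[OF B z nz] ev
  proof eventually_elim
    case (elim t)
    then obtain x where x: "B t *v x = z t *s x" "x $ k \<noteq> 0"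
      unfolding eigenvalue_def by blast
    then have "B t *v (inverse (x $ k) *s x) = z t *s (inverse (x $ k) *s x)"
      by (simp add: vector_scalar_commute vector_smult_assoc mult.commute)
    then show ?case
      using x(2) by (intro exI[of _ "inverse (x $ k) *s x"]) simp
  qed
  then have "\<forall>\<^sub>F t in F. B t *v (SOME x. B t *v x = z t *s x \<and> x $ k = 1)
      = z t *s (SOME x. B t *v x = z t *s x \<and> x $ k = 1)
      \<and> (SOME x. B t *v x = z t *s x \<and> x $ k = 1) $ k = 1"
    by eventually_elim (rule someI_ex)
  then show thesis by (rule that)
qed

text \<open>If \<open>x\<close> and \<open>y\<close> are eigenvectors for \<open>z\<close> and \<open>w\<close> with entry 1 at \<open>k\<close>, then \<open>z - B\<close> bordered by \<open>y\<close>
  annihilates the vector that agrees with \<open>x - y\<close> off \<open>k\<close> and has \<open>z - w\<close> at \<open>k\<close>. This bordered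
  matrix converges to an invertible one, so eventually \<open>z = w\<close>.\<close>

lemma simple_eigenvalue_locally_unique:
  fixes B :: "'b \<Rightarrow> 'a::real_normed_field^'n^'n"
  assumes B: "(B \<longlongrightarrow> A) F" and z: "(z \<longlongrightarrow> l) F" and w: "(w \<longlongrightarrow> l) F"
    and v: "A *v v = l *s v" "v $ k = 1"
    and nz: "det (replace_column k v (mat l - A)) \<noteq> 0"
    and ev: "\<forall>\<^sub>F t in F. eigenvalue (B t) (z t)" "\<forall>\<^sub>F t in F. eigenvalue (B t) (w t)"
  shows "\<forall>\<^sub>F t in F. z t = w t"
proof -
  obtain x where x: "\<forall>\<^sub>F t in F. B t *v x t = z t *s x t \<and> x t $ k = 1"
    using eventually_eigenvector_normalized[OF B z nz ev(1)] .
  obtain y where y: "\<forall>\<^sub>F t in F. B t *v y t = w t *s y t \<and> y t $ k = 1"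
    using eventually_eigenvector_normalized[OF B w nz ev(2)] .
  have "((\<lambda>t. det (replace_column k (y t) (mat (z t) - B t))) \<longlongrightarrow> det (replace_column k v (mat l - A))) F"
    by (intro tendsto_det tendsto_replace_column tendsto_mat_minus B z eigenvector_tendsto[OF B w v nz y])
  from tendsto_imp_eventually_ne[OF this nz] x y show ?thesis
  proof eventually_elim
    case (elim t)
    define u where "u = (\<chi> j. if j = k then z t - w t else x t $ j - y t $ j)"
    have "(\<chi> j. if j = k then 0 else u $ j) = x t - y t"
      using elim by (simp add: u_def vec_eq_iff)
    then have "replace_column k (y t) (mat (z t) - B t) *v u
        = (mat (z t) - B t) *v (x t - y t) + (z t - w t) *s y t"
      unfolding replace_column_mult by (simp add: u_def)
    also have "\<dots> = 0"
      using elim by (simp add: matrix_vector_mult_diff_distrib mat_minus_mult vector_sub_rdistrib)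
    finally have "u = 0"
      using elim det_zero_iff_kernel by blast
    then have "u $ k = 0" by simp
    then show ?case by (simp add: u_def)
  qed
qed

text \<open>The determinant of \<open>x - A\<close> changes sign at the simple root \<open>l\<close>. The signs at two points on either
  side of \<open>l\<close> persist for nearby \<open>B\<close>, and the intermediate value theorem gives a root.\<close>

lemma eventually_real_eigenvalue_near:
  fixes A :: "real^'n^'n"
  assumes v: "A *v v = l *s v" "v $ k = 1"
    and nz: "det (replace_column k v (mat l - A)) \<noteq> 0" and "\<epsilon> > 0"
  shows "\<forall>\<^sub>F B in nhds A. \<exists>x. \<bar>x - l\<bar> < \<epsilon> \<and> det (mat x - B) = 0"
proof -
  define h where "h x = det (replace_column k v (mat x - A))" for x
  have "((\<lambda>x. h x * h l) \<longlongrightarrow> h l * h l) (nhds l)"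
    unfolding h_def
    by (intro tendsto_intros tendsto_det tendsto_replace_column tendsto_mat_minus) (simp add: filterlim_ident)
  moreover have "h l * h l > 0"
    using nz by (simp add: h_def zero_less_mult_iff) linarith
  ultimately have "\<forall>\<^sub>F x in nhds l. h x * h l > 0"
    by (rule order_tendstoD)
  then obtain d where d: "d > 0" "\<And>x. dist x l < d \<Longrightarrow> h x * h l > 0"
    unfolding eventually_nhds_metric by blast
  \<comment> \<open>Halved for strict inequalities: \<open>h\<close> keeps its sign on \<open>[l - e, l + e]\<close>.\<close>
  define e where "e = min \<epsilon> d / 2"
  have e: "0 < e" "e < \<epsilon>" "e < d"
    using d(1) \<open>\<epsilon> > 0\<close> by (auto simp: e_def)
  have "h (l + e) * h l > 0" "h (l - e) * h l > 0"
    using e by (auto intro!: d(2) simp: dist_real_def)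
  then have "h (l + e) * h (l - e) > 0"
    by (auto simp: zero_less_mult_iff)
  moreover have "det (mat (l + e) - A) * det (mat (l - e) - A) = - (e * e * (h (l + e) * h (l - e)))"
    by (simp add: det_mat_minus_factor[OF v] h_def)
  ultimately have neg: "det (mat (l + e) - A) * det (mat (l - e) - A) < 0"
    using e by simp
  have "((\<lambda>B. det (mat (l + e) - B) * det (mat (l - e) - B)) \<longlongrightarrow> det (mat (l + e) - A) * det (mat (l - e) - A)) (nhds A)"
    by (intro tendsto_intros tendsto_det) (simp_all add: filterlim_ident)
  from order_tendstoD(2)[OF this neg] show ?thesis
  proof eventually_elim
    case (elim B)
    have cont: "continuous_on S (\<lambda>x. det (mat x - B))" for S
      unfolding continuous_on_def by (intro ballI tendsto_det tendsto_mat_minus tendsto_const tendsto_ident_at)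
    have "\<exists>x\<ge>l - e. x \<le> l + e \<and> det (mat x - B) = 0"
    proof (cases "det (mat (l - e) - B) \<le> 0")
      case True
      with elim have "0 \<le> det (mat (l + e) - B)" by (simp add: mult_less_0_iff)
      with True show ?thesis
        using IVT'[of "\<lambda>x. det (mat x - B)" "l - e" 0 "l + e"] cont e by auto
    next
      case False
      with elim have "det (mat (l + e) - B) \<le> 0" by (simp add: mult_less_0_iff)
      with False show ?thesis
        using IVT2'[of "\<lambda>x. det (mat x - B)" "l + e" 0 "l - e"] cont e by auto
    qed
    then obtain x where "l - e \<le> x" "x \<le> l + e" "det (mat x - B) = 0" by blast
    with e show ?case by (intro exI[of _ x]) auto
  qed
qed

text \<open>Selecting the real eigenvalue nearest to \<open>l\<close> merges the roots found for the various \<open>\<epsilon>\<close> into a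
  single function.\<close>

lemma continuous_real_eigenvalue_selection:
  fixes A :: "real^'n^'n"
  assumes v: "A *v v = l *s v" "v $ k = 1"
    and nz: "det (replace_column k v (mat l - A)) \<noteq> 0"
  obtains r where "(r \<longlongrightarrow> l) (nhds A)" "\<forall>\<^sub>F B in nhds A. det (mat (r B) - B) = 0"
proof -
  define nearest where "nearest B x \<longleftrightarrow> det (mat x - B) = 0 \<and> (\<forall>y. det (mat y - B) = 0 \<longrightarrow> dist l x \<le> dist l y)"
    for B :: "real^'n^'n" and x
  have ex: "\<exists>x. nearest B x" if "det (mat y - B) = 0" for B y
  proof -
    have "closed ((\<lambda>x. det (mat x - B)) -` {0})"
      by (intro closed_vimage closed_singleton)
        (auto simp: continuous_on_def intro!: tendsto_det tendsto_mat_minus tendsto_const tendsto_ident_at)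
    then show ?thesis
      using distance_attains_inf[of "(\<lambda>x. det (mat x - B)) -` {0}" l] that
      by (auto simp: nearest_def)
  qed
  define r where "r B = (SOME x. nearest B x)" for B
  have r: "nearest B (r B)" if "det (mat y - B) = 0" for B y
    unfolding r_def using ex[OF that] by (rule someI_ex)
  show thesis
  proof (rule that)
    show "(r \<longlongrightarrow> l) (nhds A)"
    proof (rule tendstoI)
      fix \<epsilon> :: real assume "\<epsilon> > 0"
      from eventually_real_eigenvalue_near[OF v nz this] show "\<forall>\<^sub>F B in nhds A. dist (r B) l < \<epsilon>"
      proof eventually_elim
        case (elim B)
        then obtain x where x: "\<bar>x - l\<bar> < \<epsilon>" "det (mat x - B) = 0" by blast
        with r[of x B] have "dist l (r B) \<le> dist l x" by (auto simp: nearest_def)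
        with x(1) show ?case by (simp add: dist_real_def)
      qed
    qed
    show "\<forall>\<^sub>F B in nhds A. det (mat (r B) - B) = 0"
      using eventually_real_eigenvalue_near[OF v nz zero_less_one]
      by eventually_elim (use r nearest_def in blast)
  qed
qed

lemma tendsto_complexify:
  assumes "(B \<longlongrightarrow> A) F"
  shows "((\<lambda>t. complexify (B t)) \<longlongrightarrow> complexify A) F"
  by (intro vec_tendstoI) (simp add: complexify_def tendsto_of_real tendsto_vec_nth assms)

text \<open>If matrices \<open>B \<longlongrightarrow> A\<close> had eigenvalues \<open>z \<noteq> r B\<close> with \<open>Re z \<ge> r B\<close>, a subsequence of these would
  converge to an eigenvalue of \<open>A\<close> with real part at least \<open>l\<close>, that is, to \<open>l\<close>. Near \<open>l\<close>, however,
  \<open>r B\<close> is the only eigenvalue of \<open>B\<close>.\<close>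

lemma leading_eigenvalue_perturbation:
  fixes A :: "real^'n^'n"
  assumes lead: "leading_eigenvalue A l"
    and v: "A *v v = l *s v" "v $ k = 1"
    and nz: "det (replace_column k v (mat l - A)) \<noteq> 0"
  obtains r where "(r \<longlongrightarrow> l) (nhds A)"
    "\<forall>\<^sub>F B in nhds A. leading_eigenvalue B (r B) \<and> simple_eigenvalue B (r B) \<and>
       (\<exists>c. B *v c = r B *s c \<and> c $ k = 1)"
proof -
  obtain r where r: "(r \<longlongrightarrow> l) (nhds A)" and root: "\<forall>\<^sub>F B in nhds A. det (mat (r B) - B) = 0"
    using continuous_real_eigenvalue_selection[OF v nz] .
  have id: "((\<lambda>B. B) \<longlongrightarrow> A) (nhds A)"
    by (simp add: filterlim_ident)
  obtain c where c: "\<forall>\<^sub>F B in nhds A. B *v c B = r B *s c B \<and> c B $ k = 1"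
    using eventually_eigenvector_normalized[OF id r nz] root unfolding eigenvalue_iff_det by blast
  have "((\<lambda>B. det (replace_column k (c B) (mat (r B) - B))) \<longlongrightarrow> det (replace_column k v (mat l - A))) (nhds A)"
    by (intro tendsto_det tendsto_replace_column tendsto_mat_minus r id eigenvector_tendsto[OF id r v nz c])
  from tendsto_imp_eventually_ne[OF this nz] c have simple: "\<forall>\<^sub>F B in nhds A. simple_eigenvalue B (r B)"
    by eventually_elim (use simple_eigenvalue_iff in blast)
  define vc :: "complex^'n" where "vc = (\<chi> i. of_real (v $ i))"
  have vc: "complexify A *v vc = of_real l *s vc" "vc $ k = 1"
    using v unfolding vec_eq_iff
    by (simp_all add: vc_def complexify_def matrix_vector_mult_def flip: of_real_mult of_real_sum)
  have nzc: "det (replace_column k vc (mat (of_real l) - complexify A)) \<noteq> 0"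
    using simple_eigenvalue_iff[OF v] order_charpoly_eq_1_iff[OF vc] nz
    by (simp add: simple_eigenvalue_def)
  have cev: "eigenvalue (complexify B) (of_real x) \<longleftrightarrow> det (mat x - B) = 0" for B :: "real^'n^'n" and x
    by (simp add: eigenvalue_iff_det det_mat_minus_complexify)
  define Q where "Q B \<longleftrightarrow> (\<forall>\<mu>. eigenvalue (complexify B) \<mu> \<and> \<mu> \<noteq> of_real (r B) \<longrightarrow> Re \<mu> < r B)" for B
  have "eventually Q (inf (nhds A) (principal UNIV))"
  proof (rule sequentially_imp_eventually_nhds_within, intro allI impI, elim conjE, rule ccontr)
    fix f :: "nat \<Rightarrow> real^'n^'n" assume f: "f \<longlonglongrightarrow> A" and "\<not> (\<forall>\<^sub>F n in sequentially. Q (f n))"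
    then obtain g :: "nat \<Rightarrow> nat" where g: "strict_mono g" "\<And>n. \<not> Q (f (g n))"
      using not_eventually_sequentiallyD by blast
    then have "\<forall>n. \<exists>z. eigenvalue (complexify (f (g n))) z \<and> z \<noteq> of_real (r (f (g n))) \<and> r (f (g n)) \<le> Re z"
      unfolding Q_def by (force simp: not_less)
    then obtain z where z: "\<And>n. eigenvalue (complexify (f (g n))) (z n)" "\<And>n. z n \<noteq> of_real (r (f (g n)))"
        "\<And>n. r (f (g n)) \<le> Re (z n)"
      by metis
    have fg: "(\<lambda>n. f (g n)) \<longlonglongrightarrow> A"
      using LIMSEQ_subseq_LIMSEQ[OF f g(1)] by (simp add: o_def)
    define C where "C n = (\<Sum>i\<in>UNIV. \<Sum>j\<in>UNIV. norm (complexify (f (g n)) $ i $ j))" for n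
    have "C \<longlonglongrightarrow> (\<Sum>i\<in>UNIV. \<Sum>j\<in>UNIV. norm (complexify A $ i $ j))"
      unfolding C_def by (intro tendsto_intros tendsto_vec_nth tendsto_complexify fg)
    then have "Bseq C" by (rule convergent_imp_Bseq[OF convergentI])
    then obtain K where K: "\<And>n. norm (C n) \<le> K" by (auto simp: Bseq_def)
    have "norm (z n) \<le> K" for n
    proof -
      have "norm (z n) \<le> C n"
        using z(1)[of n] unfolding eigenvalue_def C_def by (auto intro: norm_eigenvalue_le)
      with K[of n] show ?thesis by simp
    qed
    then have "bounded (range z)" by (auto intro: boundedI)
    then obtain z0 h where h: "strict_mono h" "(z \<circ> h) \<longlonglongrightarrow> z0"
      using bounded_imp_convergent_subsequence by blast
    \<comment> \<open>Matrices along the second subsequence, for which the bad eigenvalues converge.\<close>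
    define b where "b n = f (g (h n))" for n
    have b: "b \<longlonglongrightarrow> A"
      using LIMSEQ_subseq_LIMSEQ[OF fg h(1)] by (simp add: o_def b_def[abs_def])
    have rb: "(\<lambda>n. r (b n)) \<longlonglongrightarrow> l"
      using filterlim_compose[OF r b] .
    have "(\<lambda>n. det (mat ((z \<circ> h) n) - complexify (b n))) \<longlonglongrightarrow> det (mat z0 - complexify A)"
      by (intro tendsto_det tendsto_mat_minus tendsto_complexify b h(2))
    moreover have "det (mat ((z \<circ> h) n) - complexify (b n)) = 0" for n
      using z(1)[of "h n"] by (simp add: b_def eigenvalue_iff_det)
    ultimately have "eigenvalue (complexify A) z0"
      unfolding eigenvalue_iff_det by (simp add: LIMSEQ_const_iff)
    moreover have "l \<le> Re z0"
      by (rule LIMSEQ_le[OF rb tendsto_Re[OF h(2)]]) (use z(3) in \<open>auto simp: b_def\<close>)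
    ultimately have "z0 = of_real l"
      using lead unfolding leading_eigenvalue_def by (meson not_less)
    with h(2) have "(z \<circ> h) \<longlonglongrightarrow> of_real l" by simp
    moreover have "\<forall>\<^sub>F n in sequentially. eigenvalue (complexify (b n)) (of_real (r (b n)))"
      unfolding cev using eventually_compose_filterlim[OF root b] .
    ultimately have "\<forall>\<^sub>F n in sequentially. (z \<circ> h) n = of_real (r (b n))"
      using z(1) by (intro simple_eigenvalue_locally_unique[OF tendsto_complexify[OF b] _ tendsto_of_real[OF rb] vc nzc])
        (simp_all add: b_def o_def)
    then have "\<exists>n. (z \<circ> h) n = of_real (r (b n))"
      by (rule eventually_happens'[OF sequentially_bot])
    with z(2) show False by (simp add: b_def)
  qed
  then have "eventually Q (nhds A)" by simp
  then have "\<forall>\<^sub>F B in nhds A. leading_eigenvalue B (r B)"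
    using root unfolding leading_eigenvalue_def cev Q_def by eventually_elim simp
  then have "\<forall>\<^sub>F B in nhds A. leading_eigenvalue B (r B) \<and> simple_eigenvalue B (r B) \<and>
       (\<exists>c. B *v c = r B *s c \<and> c $ k = 1)"
    using simple c by eventually_elim blast
  with r show thesis by (rule that)
qed

section \<open>The leading eigenpair as a function of the matrix\<close>

definition leading_root :: "real^'n^'n \<Rightarrow> real" where
  "leading_root A = (THE l. leading_eigenvalue A l)"

lemma leading_eigenvalue_unique:
  assumes "leading_eigenvalue A l" "leading_eigenvalue A m"
  shows "l = m"
  using assms unfolding leading_eigenvalue_def by (metis Re_complex_of_real order_less_asym)

lemma leading_root_eq: "leading_eigenvalue A l \<Longrightarrow> leading_root A = l"
  unfolding leading_root_def using leading_eigenvalue_unique by blast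

text \<open>The Jacobian matrix of \<open>(l - A) c\<close> with respect to the entries \<open>c $ Some k\<close> and to \<open>l\<close>, at the leading
  eigenpair; the derivative with respect to \<open>l\<close> is in column \<open>None\<close>.\<close>

definition bordered :: "real^('n::finite option)^('n option) \<Rightarrow> real^('n option)^('n option)" where
  "bordered A = replace_column None (centrality A) (mat (leading_root A) - A)"

lemma is_centrality_unique:
  assumes "is_centrality A c" "is_centrality A d"
  shows "c = d"
proof -
  obtain l where l: "leading_eigenvalue A l" "simple_eigenvalue A l" "A *v c = l *s c" and c: "c $ None = 1"
    using assms(1) unfolding is_centrality_def by blast
  moreover obtain m where "leading_eigenvalue A m" "A *v d = m *s d" and d: "d $ None = 1"
    using assms(2) unfolding is_centrality_def by blast
  ultimately have Ad: "A *v d = l *s d"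
    using leading_eigenvalue_unique by blast
  have "(\<chi> j. if j = None then 0 else (c - d) $ j) = c - d"
    using c d by (simp add: vec_eq_iff)
  then have "replace_column None c (mat l - A) *v (c - d) = (mat l - A) *v (c - d)"
    using c d by (simp add: replace_column_mult)
  also have "\<dots> = 0"
    by (simp add: matrix_vector_mult_diff_distrib mat_minus_mult l Ad)
  finally show ?thesis
    using simple_eigenvalue_iff[OF l(3) c] l(2) det_zero_iff_kernel
    by (metis eq_iff_diff_eq_0)
qed

lemma centrality_eqI: "is_centrality A c \<Longrightarrow> centrality A = c"
  unfolding centrality_def centrality_domain_def using is_centrality_unique by (auto intro!: the_equality)

lemma centrality_domain_iff:
  "A \<in> centrality_domain \<longleftrightarrow> (\<exists>l c. leading_eigenvalue A l \<and> simple_eigenvalue A l \<and> A *v c = l *s c \<and> c $ None = 1)"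
  unfolding centrality_domain_def is_centrality_def by blast

lemma centrality_domainD:
  assumes "A \<in> centrality_domain"
  shows "leading_eigenvalue A (leading_root A)" "A *v centrality A = leading_root A *s centrality A"
    "centrality A $ None = 1" "det (bordered A) \<noteq> 0"
proof -
  obtain c where c: "is_centrality A c"
    using assms unfolding centrality_domain_def by blast
  then obtain l where l: "leading_eigenvalue A l" "simple_eigenvalue A l" "A *v c = l *s c" "c $ None = 1"
    unfolding is_centrality_def by blast
  note eq = centrality_eqI[OF c] leading_root_eq[OF l(1)]
  show "leading_eigenvalue A (leading_root A)" "A *v centrality A = leading_root A *s centrality A"
    "centrality A $ None = 1" "det (bordered A) \<noteq> 0"
    using l simple_eigenvalue_iff[OF l(3,4)] unfolding bordered_def eq by auto
qed

text \<open>The selected eigenvalue is leading, so it is the leading root, which is therefore continuous; the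
  normalised eigenvectors follow by \<open>eigenvector_tendsto\<close>.\<close>

lemma centrality_domain_perturbation:
  fixes A :: "real^('n::finite option)^('n option)"
  assumes "A \<in> centrality_domain"
  shows "\<forall>\<^sub>F B in nhds A. B \<in> centrality_domain"
    and "(leading_root \<longlongrightarrow> leading_root A) (nhds A)"
    and "(centrality \<longlongrightarrow> centrality A) (nhds A)"
proof -
  note A = centrality_domainD[OF assms, unfolded bordered_def]
  obtain r where r: "(r \<longlongrightarrow> leading_root A) (nhds A)" and
    ev: "\<forall>\<^sub>F B in nhds A. leading_eigenvalue B (r B) \<and> simple_eigenvalue B (r B) \<and>
       (\<exists>c. B *v c = r B *s c \<and> c $ None = 1)"
    using leading_eigenvalue_perturbation[OF A] .
  show dom: "\<forall>\<^sub>F B in nhds A. B \<in> centrality_domain"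
    using ev by eventually_elim (auto simp: centrality_domain_iff)
  have "\<forall>\<^sub>F B in nhds A. r B = leading_root B"
    using ev by eventually_elim (auto simp: leading_root_eq)
  with r show root: "(leading_root \<longlongrightarrow> leading_root A) (nhds A)"
    by (rule Lim_transform_eventually)
  have "\<forall>\<^sub>F B in nhds A. B *v centrality B = leading_root B *s centrality B \<and> centrality B $ None = 1"
    using dom by eventually_elim (simp add: centrality_domainD)
  moreover have "((\<lambda>B. B) \<longlongrightarrow> A) (nhds A)"
    by (simp add: filterlim_ident)
  ultimately show "(centrality \<longlongrightarrow> centrality A) (nhds A)"
    using eigenvector_tendsto[OF _ root A(2-4), of "\<lambda>B. B" centrality] by blast
qed

lemma open_centrality_domain: "open (centrality_domain :: (real^('n::finite option)^('n option)) set)"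
proof (rule Topological_Spaces.openI)
  fix A :: "real^('n option)^('n option)" assume "A \<in> centrality_domain"
  from centrality_domain_perturbation(1)[OF this]
  show "\<exists>T. open T \<and> A \<in> T \<and> T \<subseteq> centrality_domain"
    unfolding eventually_nhds subset_eq .
qed

lemma matrix_inv_mult:
  fixes X :: "'a::field^'n^'n"
  assumes "det X \<noteq> 0"
  shows "X ** matrix_inv X = mat 1" "matrix_inv X ** X = mat 1"
  using someI_ex[OF assms[folded invertible_det_nz, unfolded invertible_def]]
  by (simp_all add: matrix_inv_def)

lemma matrix_inv_mult_vector:
  fixes X :: "'a::field^'n^'n"
  assumes "det X \<noteq> 0"
  shows "X *v (matrix_inv X *v x) = x" "matrix_inv X *v (X *v x) = x"
  by (simp_all add: matrix_vector_mul_assoc matrix_inv_mult[OF assms])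

text \<open>The entries of the inverse are rational functions of the matrix, hence as continuous and as smooth
  as the matrix itself.\<close>

lemma matrix_inv_cramer:
  fixes X :: "'a::field^'n^'n"
  assumes "det X \<noteq> 0"
  shows "matrix_inv X $ i $ m = det (replace_column i (axis m 1) X) / det X"
proof -
  have "X *v column m (matrix_inv X) = axis m 1"
    by (simp add: matrix_vector_mul_assoc matrix_inv_mult[OF assms] flip: matrix_vector_mult_axis)
  from solution_eq_cramer[OF assms this, of i] show ?thesis
    by (simp add: column_def)
qed

text \<open>Caratheodory's form of differentiability: the coefficient \<open>W\<close> only has to be continuous at \<open>x\<close>,
  because the linear factor vanishes there.\<close>

lemma has_derivative_continuous_times_vanishing:
  fixes W :: "'a::real_normed_vector \<Rightarrow> real" and L :: "'a \<Rightarrow> real"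
  assumes W: "(W \<longlongrightarrow> W x) (at x)" and L: "bounded_linear L"
  shows "((\<lambda>y. W y * L (y - x)) has_derivative (\<lambda>h. W x * L h)) (at x)"
proof (rule has_derivativeI)
  interpret L: bounded_linear L by fact
  show "bounded_linear (\<lambda>h. W x * L h)"
    by (rule bounded_linear_const_mult[OF L])
  obtain K where K: "\<And>h. norm (L h) \<le> norm h * K"
    using L.bounded by blast
  have "((\<lambda>y. norm (W y - W x) * K) \<longlongrightarrow> norm (W x - W x) * K) (at x)"
    by (intro tendsto_intros W)
  then have lim: "((\<lambda>y. norm (W y - W x) * K) \<longlongrightarrow> 0) (at x)" by simp
  show "((\<lambda>y. (W y * L (y - x) - W x * L (x - x) - W x * L (y - x)) /\<^sub>R norm (y - x)) \<longlongrightarrow> 0) (at x)"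
  proof (rule Lim_null_comparison[OF _ lim], rule eventually_at_filter[THEN iffD2], rule always_eventually, intro allI impI)
    fix y assume "y \<noteq> x"
    have "norm ((W y * L (y - x) - W x * L (x - x) - W x * L (y - x)) /\<^sub>R norm (y - x))
        = norm (W y - W x) * (norm (L (y - x)) / norm (y - x))"
      by (simp add: L.zero abs_mult divide_inverse mult.commute flip: left_diff_distrib)
    also have "\<dots> \<le> norm (W y - W x) * K"
      using K[of "y - x"] \<open>y \<noteq> x\<close> by (intro mult_left_mono) (auto simp: divide_le_eq mult.commute)
    finally show "norm ((W y * L (y - x) - W x * L (x - x) - W x * L (y - x)) /\<^sub>R norm (y - x)) \<le> norm (W y - W x) * K" .
  qed
qed

lemma has_derivative_vecI:
  fixes f :: "'b::real_normed_vector \<Rightarrow> real^'n"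
  assumes "\<And>i. ((\<lambda>x. f x $ i) has_derivative (\<lambda>h. f' h $ i)) (at x)"
  shows "(f has_derivative f') (at x)"
  using assms unfolding has_derivative_componentwise_within[of f]
  by (auto simp: Basis_vec_def inner_axis)

text \<open>The entry \<open>None\<close> of the centrality is the constant 1, so its place is free for the eigenvalue. This
  matches the column order of \<open>bordered\<close>.\<close>

definition eigenpair :: "real^('n::finite option)^('n option) \<Rightarrow> real^('n option)" where
  "eigenpair A = (\<chi> i. if i = None then leading_root A else centrality A $ i)"

text \<open>Subtract \<open>A c_A = l_A c_A\<close> from \<open>B c_B = l_B c_B\<close> and collect
  \<open>(l_A - A) (c_B - c_A) + (l_B - l_A) c_B = (B - A) c_B\<close>. Bordering by \<open>c_B\<close> rather than by \<open>c_A\<close>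
  absorbs the quadratic term.\<close>

lemma eigenpair_difference:
  assumes A: "A \<in> centrality_domain" and B: "B \<in> centrality_domain"
  shows "replace_column None (centrality B) (mat (leading_root A) - A) *v (eigenpair B - eigenpair A)
    = (B - A) *v centrality B"
proof -
  have *: "(\<chi> j. if j = None then 0 else (eigenpair B - eigenpair A) $ j) = centrality B - centrality A"
    using centrality_domainD(3)[OF A] centrality_domainD(3)[OF B] by (simp add: vec_eq_iff eigenpair_def)
  show ?thesis
    unfolding replace_column_mult *
    unfolding matrix_vector_mult_diff_distrib mat_minus_mult
      matrix_vector_mult_diff_rdistrib[of B A]
    by (simp add: eigenpair_def vector_sub_rdistrib centrality_domainD(2)[OF A] centrality_domainD(2)[OF B])
qed

lemma has_derivative_eigenpair:
  fixes A :: "real^('n::finite option)^('n option)"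
  assumes A: "A \<in> centrality_domain"
  shows "(eigenpair has_derivative (\<lambda>H. matrix_inv (bordered A) *v (H *v centrality A))) (at A)"
proof (rule has_derivative_vecI)
  fix i
  \<comment> \<open>The matrix of \<open>eigenpair_difference\<close>: only its border depends on \<open>B\<close>. The coefficient of the
    entry \<open>(m, n)\<close> of \<open>B - A\<close> in the difference of the eigenpairs is \<open>W m n B\<close>.\<close>
  define G where "G B = replace_column None (centrality B) (mat (leading_root A) - A)" for B
  define W where "W m n B = det (replace_column i (axis m 1) (G B)) / det (G B) * centrality B $ n" for m n B
  have GA: "G A = bordered A" by (simp add: G_def bordered_def)
  note nz = centrality_domainD(4)[OF A, folded GA]
  have id: "((\<lambda>B. B) \<longlongrightarrow> A) (nhds A)" by (simp add: filterlim_ident)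
  have cont: "(centrality \<longlongrightarrow> centrality A) (nhds A)"
    by (rule centrality_domain_perturbation[OF A])
  have "((\<lambda>B. det (G B)) \<longlongrightarrow> det (G A)) (nhds A)"
    unfolding G_def by (intro tendsto_det tendsto_replace_column tendsto_const cont)
  note G_nz = tendsto_imp_eventually_ne[OF this nz]
  have W: "(W m n \<longlongrightarrow> W m n A) (at A)" for m n
  proof (rule tendsto_mono)
    show "at A \<le> nhds A" by (simp add: at_within_def)
    show "(W m n \<longlongrightarrow> W m n A) (nhds A)"
      using nz unfolding W_def G_def
      by (intro tendsto_mult tendsto_divide tendsto_vec_nth tendsto_det tendsto_replace_column tendsto_const cont)
  qed
  have expand: "(matrix_inv (G B) *v (H *v centrality B)) $ i = (\<Sum>m\<in>UNIV. \<Sum>n\<in>UNIV. W m n B * H $ m $ n)"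
    if "det (G B) \<noteq> 0" for B H
    by (simp add: W_def matrix_vector_mult_def matrix_inv_cramer[OF that] sum_distrib_left mult_ac)
  have "((\<lambda>B. eigenpair A $ i + (\<Sum>m\<in>UNIV. \<Sum>n\<in>UNIV. W m n B * (B - A) $ m $ n)) has_derivative
      (\<lambda>H. 0 + (\<Sum>m\<in>UNIV. \<Sum>n\<in>UNIV. W m n A * H $ m $ n))) (at A)"
    by (intro has_derivative_add has_derivative_const has_derivative_sum
        has_derivative_continuous_times_vanishing[where L = "\<lambda>H. H $ _ $ _"] W
        bounded_linear_compose[OF bounded_linear_vec_nth bounded_linear_vec_nth])
  moreover
  have "\<forall>\<^sub>F B in nhds A. eigenpair A $ i + (\<Sum>m\<in>UNIV. \<Sum>n\<in>UNIV. W m n B * (B - A) $ m $ n) = eigenpair B $ i"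
    using centrality_domain_perturbation(1)[OF A] G_nz
  proof eventually_elim
    case (elim B)
    have "matrix_inv (G B) *v (G B *v (eigenpair B - eigenpair A)) = matrix_inv (G B) *v ((B - A) *v centrality B)"
      unfolding G_def eigenpair_difference[OF A elim(1)] ..
    then have "eigenpair B - eigenpair A = matrix_inv (G B) *v ((B - A) *v centrality B)"
      by (simp add: matrix_vector_mul_assoc matrix_inv_mult[OF elim(2)])
    then show ?case
      using expand[OF elim(2), of "B - A"] by (metis add_diff_cancel_left' diff_add_cancel add.commute vector_minus_component)
  qed
  then have "\<forall>\<^sub>F B in at A. eigenpair A $ i + (\<Sum>m\<in>UNIV. \<Sum>n\<in>UNIV. W m n B * (B - A) $ m $ n) = eigenpair B $ i"
    by (auto simp: eventually_at_filter elim: eventually_mono)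
  ultimately have "((\<lambda>B. eigenpair B $ i) has_derivative (\<lambda>H. 0 + (\<Sum>m\<in>UNIV. \<Sum>n\<in>UNIV. W m n A * H $ m $ n))) (at A)"
    by (rule has_derivative_transform_eventually) auto
  then show "((\<lambda>B. eigenpair B $ i) has_derivative (\<lambda>H. (matrix_inv (bordered A) *v (H *v centrality A)) $ i)) (at A)"
    unfolding GA[symmetric] expand[OF nz] by simp
qed

section \<open>Smoothness of the centrality\<close>

lemma C_k_cong:
  assumes "open S" "\<And>x. x \<in> S \<Longrightarrow> f x = g x" "C_k k S f"
  shows "C_k k S g"
  using assms(2,3)
proof (induction k arbitrary: f g)
  case 0
  then show ?case by (simp cong: continuous_on_cong)
next
  case (Suc k)
  have der: "(g has_derivative frechet_derivative f (at x)) (at x)" if "x \<in> S" for x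
    using has_derivative_transform_within_open[OF _ assms(1) that] Suc.prems that
    by (metis C_k.simps(2) frechet_derivative_works)
  have "C_k k S (\<lambda>x. frechet_derivative g (at x) v)" for v
  proof (rule Suc.IH)
    show "C_k k S (\<lambda>x. frechet_derivative f (at x) v)"
      using Suc.prems(2) by simp
    show "frechet_derivative f (at x) v = frechet_derivative g (at x) v" if "x \<in> S" for x
      using frechet_derivative_at[OF der[OF that]] by simp
  qed
  with der show ?case by (auto simp: differentiable_def)
qed

text \<open>Lets a derivative be given by any formula valid on \<open>S\<close>, instead of by \<open>frechet_derivative\<close>.\<close>

lemma C_k_SucI:
  assumes "open S" "\<And>x. x \<in> S \<Longrightarrow> (f has_derivative f' x) (at x)" "\<And>v. C_k k S (\<lambda>x. f' x v)"
  shows "C_k (Suc k) S f"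
proof -
  have "C_k k S (\<lambda>x. frechet_derivative f (at x) v)" for v
    by (rule C_k_cong[OF assms(1) _ assms(3)]) (use frechet_derivative_at[OF assms(2)] in simp)
  with assms(2) show ?thesis by (auto simp: differentiable_def)
qed

lemma C_k_SucD:
  assumes "C_k (Suc k) S f" "x \<in> S"
  shows "(f has_derivative frechet_derivative f (at x)) (at x)"
  using assms by (simp add: frechet_derivative_works)

lemma C_k_lower: "C_k (Suc k) S f \<Longrightarrow> C_k k S f"
proof (induction k arbitrary: f)
  case 0
  then show ?case
    by (auto intro!: continuous_at_imp_continuous_on differentiable_imp_continuous_within)
qed simp

lemma C_k_const: "C_k k S (\<lambda>_. c)"
  by (induction k arbitrary: c) auto

lemma C_k_bounded_linear:
  assumes "open S" "bounded_linear f"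
  shows "C_k k S f"
proof (cases k)
  case 0
  then show ?thesis by (simp add: assms(2) linear_continuous_on)
next
  case (Suc k)
  show ?thesis
    unfolding Suc by (rule C_k_SucI[where f' = "\<lambda>_. f"]) (simp_all add: assms bounded_linear_imp_has_derivative C_k_const)
qed

lemma C_k_add:
  assumes "open S" "C_k k S f" "C_k k S g"
  shows "C_k k S (\<lambda>x. f x + g x)"
  using assms(2,3)
proof (induction k arbitrary: f g)
  case 0
  then show ?case by (simp add: continuous_on_add)
next
  case (Suc k)
  show ?case
    by (rule C_k_SucI[OF assms(1) has_derivative_add[OF C_k_SucD C_k_SucD], OF Suc.prems(1) _ Suc.prems(2)])
      (use Suc in simp_all)
qed

lemma C_k_mult:
  fixes f g :: "_ \<Rightarrow> real"
  assumes "open S" "C_k k S f" "C_k k S g"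
  shows "C_k k S (\<lambda>x. f x * g x)"
  using assms(2,3)
proof (induction k arbitrary: f g)
  case 0
  then show ?case by (simp add: continuous_on_mult)
next
  case (Suc k)
  show ?case
  proof (rule C_k_SucI[OF assms(1) has_derivative_mult[OF C_k_SucD C_k_SucD], OF Suc.prems(1) _ Suc.prems(2)])
    show "C_k k S (\<lambda>x. f x * frechet_derivative g (at x) v + frechet_derivative f (at x) v * g x)" for v
      using Suc.prems C_k_lower[OF Suc.prems(1)] C_k_lower[OF Suc.prems(2)]
      by (intro C_k_add[OF assms(1)] Suc.IH) simp_all
  qed
qed

lemma C_k_inverse:
  fixes f :: "_ \<Rightarrow> real"
  assumes "open S" "C_k k S f" "\<And>x. x \<in> S \<Longrightarrow> f x \<noteq> 0"
  shows "C_k k S (\<lambda>x. inverse (f x))"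
  using assms(2)
proof (induction k)
  case 0
  then show ?case by (simp add: continuous_on_inverse assms(3))
next
  case (Suc k)
  have inv: "C_k k S (\<lambda>x. inverse (f x))"
    by (rule Suc.IH[OF C_k_lower[OF Suc.prems]])
  show ?case
  proof (rule C_k_SucI[OF assms(1) Deriv.has_derivative_inverse[OF assms(3) C_k_SucD[OF Suc.prems]]])
    have "C_k k S (\<lambda>x. (-1) * (inverse (f x) * frechet_derivative f (at x) v * inverse (f x)))" for v
      using Suc.prems by (intro C_k_mult[OF assms(1)] inv C_k_const) auto
    then show "C_k k S (\<lambda>x. - (inverse (f x) * frechet_derivative f (at x) v * inverse (f x)))" for v
      by simp
  qed
qed

lemma C_k_sum:
  fixes f :: "'i \<Rightarrow> 'a::real_normed_vector \<Rightarrow> 'b::real_normed_vector"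
  assumes "open S" "\<And>i. i \<in> I \<Longrightarrow> C_k k S (f i)"
  shows "C_k k S (\<lambda>x. \<Sum>i\<in>I. f i x)"
  using assms(2) by (induction I rule: infinite_finite_induct) (simp_all add: C_k_const C_k_add assms(1))

lemma C_k_prod:
  fixes f :: "'i \<Rightarrow> 'a::real_normed_vector \<Rightarrow> real"
  assumes "open S" "\<And>i. i \<in> I \<Longrightarrow> C_k k S (f i)"
  shows "C_k k S (\<lambda>x. \<Prod>i\<in>I. f i x)"
  using assms(2) by (induction I rule: infinite_finite_induct) (simp_all add: C_k_const C_k_mult assms(1))

lemma C_k_det:
  fixes X :: "'a::real_normed_vector \<Rightarrow> real^'n^'n"
  assumes "open S" "\<And>i j. C_k k S (\<lambda>x. X x $ i $ j)"
  shows "C_k k S (\<lambda>x. det (X x))"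
  unfolding det_def by (intro C_k_sum C_k_mult C_k_prod C_k_const assms)

lemma C_k_vecI:
  fixes f :: "'a::real_normed_vector \<Rightarrow> real^'n"
  assumes "open S" "\<And>i. C_k k S (\<lambda>x. f x $ i)"
  shows "C_k k S f"
  using assms(2)
proof (induction k arbitrary: f)
  case 0
  then show ?case by (auto simp: continuous_on_def intro: vec_tendstoI)
next
  case (Suc k)
  show ?case
  proof (rule C_k_SucI[OF assms(1)])
    show "(f has_derivative (\<lambda>v. \<chi> i. frechet_derivative (\<lambda>x. f x $ i) (at x) v)) (at x)" if "x \<in> S" for x
      by (rule has_derivative_vecI) (simp add: C_k_SucD[OF Suc.prems that])
    show "C_k k S (\<lambda>x. \<chi> i. frechet_derivative (\<lambda>x. f x $ i) (at x) v)" for v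
      by (rule Suc.IH) (use Suc.prems in simp)
  qed
qed

text \<open>Bootstrapping: Cramer's rule writes the derivative as a rational function of the entries of \<open>A\<close> and
  of the eigenpair itself, so it inherits the class \<open>C_k\<close> that the eigenpair is known to have.\<close>

lemma C_k_eigenpair:
  "C_k k centrality_domain (\<lambda>A :: real^('n::finite option)^('n option). eigenpair A $ i)"
proof (induction k arbitrary: i)
  case 0
  have "isCont (\<lambda>A. eigenpair A $ i) A" if "A \<in> centrality_domain" for A :: "real^('n option)^('n option)"
    using has_derivative_continuous[OF has_derivative_eigenpair[OF that]] by (rule isCont_vec_nth)
  then show ?case by (auto intro: continuous_at_imp_continuous_on)
next
  case (Suc k)
  let ?D = "centrality_domain :: (real^('n option)^('n option)) set"
  note o = open_centrality_domain
  have entry: "C_k k ?D (\<lambda>A. A $ a $ b)" for a b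
    by (intro C_k_bounded_linear o bounded_linear_compose[OF bounded_linear_vec_nth bounded_linear_vec_nth])
  have c: "C_k k ?D (\<lambda>A. centrality A $ a)" for a
  proof (cases a)
    case None
    show ?thesis
      unfolding None by (rule C_k_cong[OF o _ C_k_const[of k _ 1]]) (simp add: centrality_domainD(3))
  next
    case (Some b)
    show ?thesis
      using Suc.IH[of a] by (simp add: eigenpair_def Some)
  qed
  have l: "C_k k ?D leading_root"
    using Suc.IH[of None] by (simp add: eigenpair_def)
  have G: "C_k k ?D (\<lambda>A. bordered A $ a $ b)" for a b
  proof (cases "b = None")
    case True
    then show ?thesis by (simp add: bordered_def replace_column_def c)
  next
    case False
    have "C_k k ?D (\<lambda>A. mat 1 $ a $ b * leading_root A + (-1) * A $ a $ b)"
      by (intro C_k_add C_k_mult C_k_const o l entry)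
    moreover have "(\<lambda>A. mat 1 $ a $ b * leading_root A + (-1) * A $ a $ b) = (\<lambda>A. bordered A $ a $ b)"
      using False by (auto simp: bordered_def replace_column_def mat_def)
    ultimately show ?thesis by simp
  qed
  show ?case
  proof (rule C_k_SucI[OF o])
    show "((\<lambda>A. eigenpair A $ i) has_derivative (\<lambda>H. (matrix_inv (bordered A) *v (H *v centrality A)) $ i)) (at A)"
      if "A \<in> centrality_domain" for A :: "real^('n option)^('n option)"
      by (rule bounded_linear.has_derivative[OF bounded_linear_vec_nth has_derivative_eigenpair[OF that]])
    show "C_k k ?D (\<lambda>A. (matrix_inv (bordered A) *v (H *v centrality A)) $ i)" for H
    proof (rule C_k_cong[OF o])
      show "(\<Sum>m\<in>UNIV. det (replace_column i (axis m 1) (bordered A)) * inverse (det (bordered A))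
          * (\<Sum>n\<in>UNIV. H $ m $ n * centrality A $ n)) = (matrix_inv (bordered A) *v (H *v centrality A)) $ i"
        if "A \<in> centrality_domain" for A :: "real^('n option)^('n option)"
        using centrality_domainD(4)[OF that]
        by (simp add: matrix_vector_mult_def matrix_inv_cramer divide_inverse)
      have rc: "C_k k ?D (\<lambda>A. replace_column i (axis m 1) (bordered A) $ a $ b)" for m a b
        by (cases "b = i") (simp_all add: replace_column_def C_k_const G)
      show "C_k k ?D (\<lambda>A. \<Sum>m\<in>UNIV. det (replace_column i (axis m 1) (bordered A)) * inverse (det (bordered A))
          * (\<Sum>n\<in>UNIV. H $ m $ n * centrality A $ n))"
        by (intro C_k_sum C_k_mult C_k_inverse C_k_det C_k_const o rc G c) (simp add: centrality_domainD(4))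
    qed
  qed
qed

theorem smooth_on_centrality:
  "smooth_on centrality_domain (centrality :: real^('n::finite option)^('n option) \<Rightarrow> _)"
  unfolding smooth_on_def
proof (intro allI C_k_vecI open_centrality_domain)
  fix k and i :: "'n option"
  show "C_k k centrality_domain (\<lambda>A :: real^('n::finite option)^('n option). centrality A $ i)"
  proof (cases i)
    case None
    show ?thesis
      unfolding None by (rule C_k_cong[OF open_centrality_domain _ C_k_const[of k _ 1]]) (simp add: centrality_domainD(3))
  next
    case (Some j)
    show ?thesis
      using C_k_eigenpair[of k i] by (simp add: eigenpair_def Some)
  qed
qed

section \<open>Linear functionals of the multivariate normal distribution\<close>

lemma inner_matrix_vector_mult: "x \<bullet> (A *v y) = (transpose A *v x) \<bullet> y" for A :: "real^'n^'m"
  by (metis dot_lmul_matrix vector_transpose_matrix transpose_transpose)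

lemma borel_measurable_matrix_vector_mult [measurable (raw)]:
  fixes A :: "real^'n^'m"
  assumes "f \<in> borel_measurable M"
  shows "(\<lambda>x. A *v f x) \<in> borel_measurable M"
  using assms
  by (rule borel_measurable_continuous_on[rotated])
    (intro linear_continuous_on matrix_vector_mul_bounded_linear)

lemma prod_Basis_vec: "(\<Prod>b\<in>Basis. f b) = (\<Prod>i\<in>UNIV. f (axis i 1))" for f :: "real^'n \<Rightarrow> 'b::comm_monoid_mult"
proof -
  have "Basis = range (\<lambda>i. axis i 1 :: real^'n)"
    by (auto simp: Basis_vec_def)
  then have "(\<Prod>b\<in>Basis. f b) = prod f (range (\<lambda>i. axis i 1))"
    by (simp only:)
  also have "\<dots> = (\<Prod>i\<in>UNIV. f (axis i 1))"
    by (subst prod.reindex) (auto simp: inj_on_def axis_eq_axis)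
  finally show ?thesis .
qed

text \<open>For fixed other coordinates, the shear translates the \<open>m\<close>-th coordinate; integrate over that one
  first.\<close>

lemma nn_integral_shear:
  fixes f :: "real^'n \<Rightarrow> ennreal"
  assumes mn: "m \<noteq> n" and [measurable]: "f \<in> borel_measurable borel"
  shows "(\<integral>\<^sup>+x. f (x + x $ n *\<^sub>R axis m 1) \<partial>lborel) = (\<integral>\<^sup>+x. f x \<partial>lborel)"
proof -
  interpret product_sigma_finite "\<lambda>_::real^'n. lborel :: real measure" ..
  define I where "I = Basis - {axis m 1 :: real^'n}"
  have Basis: "Basis = insert (axis m 1) I" "axis m 1 \<notin> I" "finite I"
    by (auto simp: I_def)
  have n: "axis n 1 \<in> I"
    using mn by (auto simp: I_def axis_eq_axis)
  define e where "e x = (\<Sum>b\<in>Basis. x b *\<^sub>R b)" for x :: "real^'n \<Rightarrow> real"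
  have e [measurable]: "e \<in> borel_measurable (Pi\<^sub>M Basis (\<lambda>_. lborel))"
    unfolding e_def[abs_def] by measurable
  have e_nth: "e x $ i = x (axis i 1)" for x i
  proof -
    have "e x $ i = e x \<bullet> axis i 1" by (simp add: inner_axis)
    also have "\<dots> = x (axis i 1)"
      unfolding e_def by (rule inner_sum_left_Basis) simp
    finally show ?thesis .
  qed
  \<comment> \<open>The factor \<open>1 *\<close> brings the translation into the shape of the affine substitution rule.\<close>
  have upd: "e (x(axis m 1 := y)) + e (x(axis m 1 := y)) $ n *\<^sub>R axis m 1
      = e (x(axis m 1 := x (axis n 1) + 1 * y))" for x y
  proof -
    have "axis m (1::real) $ i = (if i = m then 1 else 0)" for i
      by (simp add: axis_def)
    then show ?thesis
      unfolding vec_eq_iff using mn by (auto simp: e_nth axis_eq_axis)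
  qed
  have lb: "(\<integral>\<^sup>+x. h x \<partial>lborel) = (\<integral>\<^sup>+x. \<integral>\<^sup>+y. h (e (x(axis m 1 := y))) \<partial>lborel \<partial>Pi\<^sub>M I (\<lambda>_. lborel))"
    if [measurable]: "h \<in> borel_measurable borel" for h :: "real^'n \<Rightarrow> ennreal"
  proof -
    have "(\<integral>\<^sup>+x. h x \<partial>lborel) = (\<integral>\<^sup>+x. h (e x) \<partial>Pi\<^sub>M Basis (\<lambda>_. lborel))"
      unfolding lborel_eq[where 'a = "real^'n"] by (simp add: nn_integral_distr e_def)
    also have "\<dots> = (\<integral>\<^sup>+x. \<integral>\<^sup>+y. h (e (x(axis m 1 := y))) \<partial>lborel \<partial>Pi\<^sub>M I (\<lambda>_. lborel))"
      unfolding Basis(1) using Basis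
      by (intro product_nn_integral_insert) (simp_all add: Basis(1)[symmetric])
    finally show ?thesis .
  qed
  have cont: "(\<lambda>y. e (x(axis m 1 := y))) \<in> borel_measurable borel" for x
  proof (rule borel_measurable_continuous_onI)
    have eq: "(\<lambda>y. e (x(axis m 1 := y))) = (\<lambda>y. \<chi> i. if i = m then y else x (axis i 1))"
      by (rule ext, subst vec_eq_iff) (simp add: e_nth axis_eq_axis)
    have "continuous_on UNIV (\<lambda>y. if i = m then y else x (axis i 1))" for i
      by (cases "i = m") simp_all
    then show "continuous_on UNIV (\<lambda>y. e (x(axis m 1 := y)))"
      unfolding eq by (rule continuous_on_vec_lambda)
  qed
  have "(\<integral>\<^sup>+x. f (x + x $ n *\<^sub>R axis m 1) \<partial>lborel)
      = (\<integral>\<^sup>+x. \<integral>\<^sup>+y. f (e (x(axis m 1 := x (axis n 1) + 1 * y))) \<partial>lborel \<partial>Pi\<^sub>M I (\<lambda>_. lborel))"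
    by (subst lb) (simp_all only: upd, measurable)
  also have "\<dots> = (\<integral>\<^sup>+x. \<integral>\<^sup>+y. f (e (x(axis m 1 := y))) \<partial>lborel \<partial>Pi\<^sub>M I (\<lambda>_. lborel))"
  proof (rule nn_integral_cong)
    fix x
    show "(\<integral>\<^sup>+y. f (e (x(axis m 1 := x (axis n 1) + 1 * y))) \<partial>lborel) = (\<integral>\<^sup>+y. f (e (x(axis m 1 := y))) \<partial>lborel)"
      using nn_integral_real_affine[of "\<lambda>y. f (e (x(axis m 1 := y)))" 1 "x (axis n 1)"] cont[of x] by simp
  qed
  also have "\<dots> = (\<integral>\<^sup>+x. f x \<partial>lborel)"
    by (rule lb[symmetric]) measurable
  finally show ?thesis .
qed

lemma nn_integral_permute_coordinates:
  fixes f :: "real^'n \<Rightarrow> ennreal"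
  assumes p: "p permutes UNIV" and [measurable]: "f \<in> borel_measurable borel"
  shows "(\<integral>\<^sup>+x. f (\<chi> i. x $ p i) \<partial>lborel) = (\<integral>\<^sup>+x. f x \<partial>lborel)"
proof -
  let ?T = "\<lambda>x :: real^'n. (\<chi> i. x $ p i)"
  let ?U = "\<lambda>x :: real^'n. (\<chi> i. x $ inv p i)"
  have T [measurable]: "?T \<in> borel_measurable borel"
    by (intro borel_measurable_continuous_onI continuous_on_vec_lambda continuous_intros)
  have eq: "lborel = distr lborel borel ?T"
  proof (rule lborel_eqI)
    fix l u :: "real^'n" assume lu: "\<And>b. b \<in> Basis \<Longrightarrow> l \<bullet> b \<le> u \<bullet> b"
    have *: "l $ i \<le> u $ i" for i
      using lu[of "axis i 1"] by (simp add: inner_axis Basis_vec_def) blast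
    have "?T -` box l u = box (?U l) (?U u)"
      using permutes_inverses[OF p] by (auto simp: mem_box_cart) metis+
    then have "emeasure (distr lborel borel ?T) (box l u) = emeasure lborel (box (?U l) (?U u))"
      by (simp add: emeasure_distr)
    also have "\<dots> = (\<Prod>b\<in>Basis. (?U u - ?U l) \<bullet> b)"
      by (rule emeasure_lborel_box) (auto simp: Basis_vec_def inner_axis *)
    also have "(\<Prod>b\<in>Basis. (?U u - ?U l) \<bullet> b) = (\<Prod>i\<in>UNIV. u $ inv p i - l $ inv p i)"
      by (simp add: prod_Basis_vec inner_axis)
    also have "\<dots> = (\<Prod>i\<in>UNIV. u $ i - l $ i)"
      using prod.permute[OF permutes_inv[OF p], of "\<lambda>i. u $ i - l $ i"] by (simp add: o_def)
    also have "\<dots> = (\<Prod>b\<in>Basis. (u - l) \<bullet> b)"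
      by (simp add: prod_Basis_vec inner_axis)
    finally show "emeasure (distr lborel borel ?T) (box l u) = (\<Prod>b\<in>Basis. (u - l) \<bullet> b)" .
  qed simp
  have "(\<integral>\<^sup>+x. f x \<partial>lborel) = (\<integral>\<^sup>+x. f x \<partial>distr lborel borel ?T)"
    by (subst eq) simp
  then show ?thesis by (simp add: nn_integral_distr)
qed

text \<open>The formula is multiplicative in \<open>A\<close>, so it suffices to check it for diagonal matrices, coordinate
  swaps and shears, which generate all invertible matrices.\<close>

lemma nn_integral_linear_substitution:
  fixes A :: "real^'n^'n" and f :: "real^'n \<Rightarrow> ennreal"
  assumes "det A \<noteq> 0" "f \<in> borel_measurable borel"
  shows "(\<integral>\<^sup>+x. f x \<partial>lborel) = ennreal \<bar>det A\<bar> * (\<integral>\<^sup>+x. f (A *v x) \<partial>lborel)"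
proof -
  define P where "P A \<longleftrightarrow> (det A \<noteq> 0 \<longrightarrow> (\<forall>f :: real^'n \<Rightarrow> ennreal. f \<in> borel_measurable borel \<longrightarrow>
      (\<integral>\<^sup>+x. f x \<partial>lborel) = ennreal \<bar>det A\<bar> * (\<integral>\<^sup>+x. f (A *v x) \<partial>lborel)))" for A :: "real^'n^'n"
  have "P A"
  proof (rule induct_matrix_elementary_alt[of P])
    fix A B :: "real^'n^'n" assume 1: "P A" "P B"
    show "P (A ** B)"
      unfolding P_def
    proof (intro impI allI)
      fix f :: "real^'n \<Rightarrow> ennreal"
      assume nz: "det (A ** B) \<noteq> 0" and f [measurable]: "f \<in> borel_measurable borel"
      have "det A \<noteq> 0" "det B \<noteq> 0" using nz by (auto simp: det_mul)
      with 1 have sub: "(\<integral>\<^sup>+x. g x \<partial>lborel) = ennreal \<bar>det A\<bar> * (\<integral>\<^sup>+x. g (A *v x) \<partial>lborel)"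
        "(\<integral>\<^sup>+x. g x \<partial>lborel) = ennreal \<bar>det B\<bar> * (\<integral>\<^sup>+x. g (B *v x) \<partial>lborel)"
        if "g \<in> borel_measurable borel" for g :: "real^'n \<Rightarrow> ennreal"
        using that unfolding P_def by blast+
      have "(\<integral>\<^sup>+x. f x \<partial>lborel) = ennreal \<bar>det A\<bar> * (\<integral>\<^sup>+x. f (A *v x) \<partial>lborel)"
        by (rule sub(1)) measurable
      also have "(\<integral>\<^sup>+x. f (A *v x) \<partial>lborel) = ennreal \<bar>det B\<bar> * (\<integral>\<^sup>+x. f (A *v (B *v x)) \<partial>lborel)"
        by (rule sub(2)) measurable
      finally show "(\<integral>\<^sup>+x. f x \<partial>lborel) = ennreal \<bar>det (A ** B)\<bar> * (\<integral>\<^sup>+x. f (A ** B *v x) \<partial>lborel)"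
        by (simp add: det_mul abs_mult ennreal_mult mult.assoc matrix_vector_mul_assoc)
    qed
  next
    fix A :: "real^'n^'n" and i assume "row i A = 0"
    then show "P A" by (simp add: P_def det_zero_row)
  next
    fix A :: "real^'n^'n" assume 3: "\<And>i j. i \<noteq> j \<Longrightarrow> A $ i $ j = 0"
    have det: "det A = (\<Prod>i\<in>UNIV. A $ i $ i)"
      by (rule det_diagonal) (use 3 in simp)
    have ax: "(\<Sum>i\<in>UNIV. A $ i $ i * axis j 1 $ i) = A $ j $ j" for j
      by (simp add: axis_def if_distrib cong: if_cong)
    have diag: "A *v x = 0 + (\<Sum>b\<in>Basis. ((\<Sum>i\<in>UNIV. A $ i $ i * b $ i) * (x \<bullet> b)) *\<^sub>R b)" (is "_ = 0 + ?s") for x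
    proof -
      have "?s $ j = ?s \<bullet> axis j 1" for j
        by (simp only: inner_axis inner_real_def mult_1_right)
      moreover have "?s \<bullet> axis j 1 = (\<Sum>i\<in>UNIV. A $ i $ i * axis j 1 $ i) * (x \<bullet> axis j 1)" for j
        by (rule inner_sum_left_Basis) simp
      ultimately have "?s $ j = A $ j $ j * x $ j" for j
        by (simp only: ax inner_axis inner_real_def mult_1_right)
      moreover have "(A *v x) $ j = A $ j $ j * x $ j" for j
      proof -
        have "(A *v x) $ j = (\<Sum>k\<in>UNIV. if k = j then A $ j $ j * x $ j else 0)"
          unfolding matrix_vector_mult_def vec_lambda_beta
          by (intro sum.cong refl) (use 3[of j] in auto)
        then show ?thesis by simp
      qed
      ultimately show ?thesis
        by (simp only: vec_eq_iff add_0 simp_thms)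
    qed
    show "P A"
      unfolding P_def
    proof (intro impI allI)
      fix f :: "real^'n \<Rightarrow> ennreal"
      assume nz: "det A \<noteq> 0" and f [measurable]: "f \<in> borel_measurable borel"
      have "lborel = density (distr lborel borel (\<lambda>x. A *v x)) (\<lambda>_. ennreal (\<Prod>b\<in>Basis. \<bar>\<Sum>i\<in>UNIV. A $ i $ i * b $ i\<bar>))"
        unfolding diag by (rule lborel_affine_euclidean) (use nz in \<open>auto simp: Basis_vec_def ax det\<close>)
      also have "(\<Prod>b\<in>Basis. \<bar>\<Sum>i\<in>UNIV. A $ i $ i * b $ i\<bar>) = \<bar>det A\<bar>"
        by (simp add: prod_Basis_vec ax det abs_prod)
      finally have "(\<integral>\<^sup>+x. f x \<partial>lborel) = (\<integral>\<^sup>+x. f x \<partial>density (distr lborel borel (\<lambda>x. A *v x)) (\<lambda>_. ennreal \<bar>det A\<bar>))"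
        by (rule arg_cong[where f = "\<lambda>M. \<integral>\<^sup>+x. f x \<partial>M"])
      then show "(\<integral>\<^sup>+x. f x \<partial>lborel) = ennreal \<bar>det A\<bar> * (\<integral>\<^sup>+x. f (A *v x) \<partial>lborel)"
        by (simp add: nn_integral_density nn_integral_distr nn_integral_cmult)
    qed
  next
    fix m n :: 'n assume "m \<noteq> n"
    have p: "Transposition.transpose m n permutes UNIV"
      by (simp add: permutes_swap_id)
    let ?S = "(\<chi> i j. mat 1 $ i $ Transposition.transpose m n j) :: real^'n^'n"
    have "\<bar>det ?S\<bar> = 1"
      unfolding det_permute_columns[OF p] by (simp add: sign_def)
    moreover have "?S *v x = (\<chi> i. x $ Transposition.transpose m n i)" for x
    proof -
      have "(\<Sum>j\<in>UNIV. mat 1 $ i $ Transposition.transpose m n j * x $ j)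
          = (\<Sum>j\<in>UNIV. if j = Transposition.transpose m n i then x $ j else 0)" for i
        by (intro sum.cong refl) (auto simp: mat_def transpose_eq_iff)
      then show ?thesis by (simp add: matrix_vector_mult_def vec_eq_iff)
    qed
    ultimately show "P ?S"
      unfolding P_def by (intro impI allI) (simp only: ennreal_1 mult_1 nn_integral_permute_coordinates[OF p])
  next
    fix m n :: 'n assume 5: "m \<noteq> n"
    let ?S = "(\<chi> i j. of_bool (i = m \<and> j = n \<or> i = j)) :: real^'n^'n"
    have "?S = (\<chi> k. if k = m then row m (mat 1) + 1 *s row n (mat 1) else row k (mat 1))"
      using 5 by (auto simp: vec_eq_iff row_def mat_def)
    then have det: "det ?S = 1"
      using det_row_operation[OF 5, of "mat 1 :: real^'n^'n" 1] by simp
    have "?S *v x = x + x $ n *\<^sub>R axis m 1" for x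
    proof -
      have "(\<Sum>j\<in>UNIV. of_bool (i = m \<and> j = n \<or> i = j) * x $ j)
          = (\<Sum>j\<in>UNIV. (if j = i then x $ i else 0) + (if j = n then of_bool (i = m) * x $ n else 0))" for i
        using 5 by (intro sum.cong refl) auto
      then show ?thesis
        by (simp add: matrix_vector_mult_def vec_eq_iff sum.distrib axis_def)
    qed
    then show "P ?S"
      unfolding P_def by (intro impI allI) (simp only: det abs_one ennreal_1 mult_1 nn_integral_shear[OF 5])
  qed
  with assms show ?thesis unfolding P_def by blast
qed

text \<open>The standard Gaussian density is a product over the coordinates, so the integral factors, and all
  factors except the \<open>k\<close>-th one have mass 1.\<close>

lemma nn_integral_std_gaussian_coordinate:
  fixes k :: "'n::finite"
  assumes [measurable]: "B \<in> sets borel"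
  shows "(\<integral>\<^sup>+y. ennreal (\<Prod>i\<in>UNIV. std_normal_density (y $ i)) * indicator B (y $ k) \<partial>(lborel :: (real^'n) measure))
    = emeasure std_normal_distribution B"
proof -
  define f :: "real^'n \<Rightarrow> real \<Rightarrow> real" where
    "f b t = std_normal_density t * (if b = axis k 1 then indicator B t else 1)" for b t
  have [measurable]: "f b \<in> borel_measurable borel" for b
    unfolding f_def by measurable
  interpret N: prob_space std_normal_distribution
    by (rule prob_space_normal_density) simp
  have 1: "(\<integral>\<^sup>+t. ennreal (std_normal_density t) \<partial>lborel) = 1"
    using N.emeasure_space_1 by (simp add: emeasure_density)
  have "(\<integral>\<^sup>+y. ennreal (\<Prod>i\<in>UNIV. std_normal_density (y $ i)) * indicator B (y $ k) \<partial>(lborel :: (real^'n) measure))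
      = (\<integral>\<^sup>+y. ennreal (\<Prod>b\<in>Basis. f b (y \<bullet> b)) \<partial>lborel)"
  proof (rule nn_integral_cong)
    fix y :: "real^'n"
    have "(\<Prod>b\<in>Basis. f b (y \<bullet> b)) = (\<Prod>i\<in>UNIV. std_normal_density (y $ i)) * indicator B (y $ k)"
      by (simp add: prod_Basis_vec f_def inner_axis axis_eq_axis prod.distrib prod.delta)
    then show "ennreal (\<Prod>i\<in>UNIV. std_normal_density (y $ i)) * indicator B (y $ k) = ennreal (\<Prod>b\<in>Basis. f b (y \<bullet> b))"
      by (simp add: ennreal_mult' prod_nonneg ennreal_indicator)
  qed
  also have "\<dots> = (\<integral>\<^sup>+y. (\<Prod>b\<in>Basis. ennreal (f b (y \<bullet> b))) \<partial>lborel)"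
    by (simp add: prod_ennreal f_def)
  also have "\<dots> = (\<Prod>b\<in>Basis. \<integral>\<^sup>+t. ennreal (f b t) \<partial>lborel)"
    by (rule nn_integral_lborel_prod) simp_all
  also have "\<dots> = (\<Prod>i\<in>UNIV. if i = k then emeasure std_normal_distribution B else 1)"
    unfolding prod_Basis_vec
  proof (intro prod.cong refl)
    fix i :: 'n
    show "(\<integral>\<^sup>+t. ennreal (f (axis i 1) t) \<partial>lborel) = (if i = k then emeasure std_normal_distribution B else 1)"
      by (simp add: f_def axis_eq_axis 1 emeasure_density ennreal_mult' ennreal_indicator)
  qed
  also have "\<dots> = emeasure std_normal_distribution B"
    by simp
  finally show ?thesis .
qed

text \<open>Gram-Schmidt for the inner product defined by \<open>\<Omega>\<close>: as long as fewer vectors than the dimension have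
  been found, some \<open>x \<noteq> 0\<close> is orthogonal to their images under \<open>\<Omega>\<close>.\<close>

lemma orthonormal_extension:
  fixes \<Omega> :: "real^'k^'k"
  assumes pd: "positive_definite \<Omega>" and a: "a \<bullet> (\<Omega> *v a) = 1"
  obtains S :: "real^'k^'k" where "column k S = a" "transpose S ** \<Omega> ** S = mat 1"
proof -
  have sym: "x \<bullet> (\<Omega> *v y) = y \<bullet> (\<Omega> *v x)" for x y
    using pd inner_matrix_vector_mult[of x \<Omega> y] by (simp add: positive_definite_def inner_commute)
  have "\<exists>s. s k = a \<and> (\<forall>i\<in>insert k J. \<forall>j\<in>insert k J. s i \<bullet> (\<Omega> *v s j) = (if i = j then 1 else 0))"
    if "finite J" "k \<notin> J" for J :: "'k set"
    using that
  proof (induction J rule: finite_induct)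
    case empty
    then show ?case using a by (intro exI[of _ "\<lambda>_. a"]) simp
  next
    case (insert m J)
    then have "\<exists>s. s k = a \<and> (\<forall>i\<in>insert k J. \<forall>j\<in>insert k J. s i \<bullet> (\<Omega> *v s j) = (if i = j then 1 else 0))"
      by simp
    then obtain s where s: "s k = a" "\<And>i j. i \<in> insert k J \<Longrightarrow> j \<in> insert k J \<Longrightarrow> s i \<bullet> (\<Omega> *v s j) = (if i = j then 1 else 0)"
      by blast
    let ?V = "(\<lambda>j. \<Omega> *v s j) ` insert k J"
    have "dim ?V \<le> card ?V"
      by (rule dim_le_card') (use insert.hyps in simp)
    also have "\<dots> \<le> card (insert k J)"
      by (rule card_image_le) (use insert.hyps in simp)
    also have "\<dots> < card (insert m (insert k J))"
      using insert by (auto simp: card_insert_if)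
    also have "\<dots> \<le> DIM(real^'k)"
      by (simp add: card_mono)
    finally obtain x where x: "x \<noteq> 0" "\<And>y. y \<in> span ?V \<Longrightarrow> orthogonal x y"
      using orthogonal_to_subspace_exists by blast
    have orth: "x \<bullet> (\<Omega> *v s j) = 0" if "j \<in> insert k J" for j
      using x(2)[OF span_base, of "\<Omega> *v s j"] that by (auto simp: orthogonal_def)
    define q where "q = x \<bullet> (\<Omega> *v x)"
    have q: "q > 0" using pd x(1) by (simp add: q_def positive_definite_def)
    define u where "u = (1 / sqrt q) *\<^sub>R x"
    have u: "u \<bullet> (\<Omega> *v u) = 1"
      using q by (simp add: u_def matrix_vector_mult_scaleR flip: q_def)
    have uo: "u \<bullet> (\<Omega> *v s j) = 0" "s j \<bullet> (\<Omega> *v u) = 0" if "j \<in> insert k J" for j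
      using orth[OF that] by (simp_all add: u_def sym[of "s j"])
    have "(s(m := u)) i \<bullet> (\<Omega> *v (s(m := u)) j) = (if i = j then 1 else 0)"
      if "i \<in> insert k (insert m J)" "j \<in> insert k (insert m J)" for i j
      using that s(2)[of i j] u uo[of i] uo[of j] by (auto split: if_splits)
    moreover have "(s(m := u)) k = a"
      using insert.prems s(1) by auto
    ultimately show ?case by blast
  qed
  from this[of "- {k}"] have "\<exists>s. s k = a \<and> (\<forall>i\<in>insert k (- {k}). \<forall>j\<in>insert k (- {k}). s i \<bullet> (\<Omega> *v s j) = (if i = j then 1 else 0))"
    by simp
  moreover have "insert k (- {k}) = UNIV" by blast
  ultimately obtain s where s: "s k = a" "\<And>i j. s i \<bullet> (\<Omega> *v s j) = (if i = j then 1 else 0)"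
    by auto
  define S :: "real^'k^'k" where "S = (\<chi> i j. s j $ i)"
  have col: "column j S = s j" for j
    by (simp add: S_def column_def vec_eq_iff)
  have "(transpose S ** \<Omega> ** S) $ i $ j = column i S \<bullet> (\<Omega> *v column j S)" for i j
    unfolding matrix_mul_assoc[symmetric]
    by (simp add: matrix_matrix_mult_def matrix_vector_mult_def inner_vec_def transpose_def column_def)
  then have "transpose S ** \<Omega> ** S = mat 1"
    by (simp add: vec_eq_iff col s(2) mat_def)
  with col[of k] s(1) show thesis by (intro that) simp_all
qed

text \<open>Let \<open>S\<close> be an \<open>\<Omega>\<close>-orthonormal basis with \<open>k\<close>-th vector \<open>a\<close>. The substitution \<open>x = \<Omega> S y\<close> turns the density
  into the standard Gaussian one, since \<open>S\<^sup>T \<Omega> S = 1\<close>, and \<open>a \<bullet> x\<close> into the coordinate \<open>y $ k\<close>.\<close>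

lemma distr_mv_normal_linear_functional:
  fixes \<Omega> :: "real^'k^'k"
  assumes pd: "positive_definite \<Omega>" and a: "a \<bullet> (\<Omega> *v a) = 1"
  shows "distr (mv_normal 0 \<Omega>) borel (\<lambda>x. a \<bullet> x) = std_normal_distribution"
proof (rule measure_eqI)
  fix B assume "B \<in> sets (distr (mv_normal 0 \<Omega>) borel (\<lambda>x. a \<bullet> x))"
  then have B [measurable]: "B \<in> sets borel" by simp
  obtain k :: 'k where True by blast
  obtain S where S: "column k S = a" "transpose S ** \<Omega> ** S = mat 1"
    using orthonormal_extension[OF pd a, of k] .
  \<comment> \<open>This is the inverse transpose of \<open>S\<close>, so that \<open>a \<bullet> (T *v y)\<close> picks out a coordinate of \<open>y\<close>.\<close>
  define T where "T = \<Omega> ** S"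
  have ST: "transpose S ** T = mat 1"
    using S(2) by (simp add: T_def matrix_mul_assoc)
  have STy: "transpose S *v (T *v y) = y" for y
    unfolding matrix_vector_mul_assoc ST by simp
  have "det S * det \<Omega> * det S = 1"
    using arg_cong[OF S(2), of det] by (simp add: det_mul)
  then have detS: "det \<Omega> * (det S)\<^sup>2 = 1" by (simp add: power2_eq_square mult_ac)
  then have "det \<Omega> > 0"
    by (metis zero_less_mult_pos2 zero_less_one zero_less_power2 mult_zero_right zero_neq_one power_zero_numeral)
  have "\<bar>det T\<bar> = sqrt (det \<Omega>)"
  proof -
    have "(det T)\<^sup>2 = det \<Omega> * (det \<Omega> * (det S)\<^sup>2)"
      by (simp add: T_def det_mul power2_eq_square mult_ac)
    then show ?thesis
      using detS real_sqrt_abs[of "det T"] by simp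
  qed
  have nzT: "det T \<noteq> 0"
    using \<open>\<bar>det T\<bar> = sqrt (det \<Omega>)\<close> \<open>det \<Omega> > 0\<close> by auto
  have inv: "matrix_inv \<Omega> ** \<Omega> = mat 1"
    using \<open>det \<Omega> > 0\<close> by (intro matrix_inv_mult) simp
  have quad: "(T *v y) \<bullet> (matrix_inv \<Omega> *v (T *v y)) = y \<bullet> y" for y
  proof -
    have "matrix_inv \<Omega> *v (T *v y) = S *v y"
      by (simp add: T_def matrix_vector_mul_assoc matrix_mul_assoc inv)
    then have "(T *v y) \<bullet> (matrix_inv \<Omega> *v (T *v y)) = (transpose S *v (T *v y)) \<bullet> y"
      using inner_matrix_vector_mult[of "T *v y" S y] by simp
    then show ?thesis
      unfolding STy .
  qed
  have coord: "a \<bullet> (T *v y) = y $ k" for y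
  proof -
    have "a \<bullet> (T *v y) = (transpose S *v (T *v y)) $ k"
      by (simp add: S(1)[symmetric] matrix_vector_mul_component transpose_def column_def inner_vec_def matrix_vector_mult_def)
    then show ?thesis unfolding STy .
  qed
  define d where "d x = exp (- ((x - 0) \<bullet> (matrix_inv \<Omega> *v (x - 0))) / 2) / sqrt ((2 * pi) ^ CARD('k) * det \<Omega>)" for x
  have dens: "\<bar>det T\<bar> * d (T *v y) = (\<Prod>i\<in>UNIV. std_normal_density (y $ i))" for y
  proof -
    have "(\<Prod>i\<in>UNIV. std_normal_density (y $ i)) = (1 / sqrt (2 * pi)) ^ CARD('k) * exp (\<Sum>i\<in>UNIV. - (y $ i)\<^sup>2 / 2)"
      by (simp add: std_normal_density_def prod_dividef exp_sum power_divide)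
    also have "(\<Sum>i\<in>UNIV. - (y $ i)\<^sup>2 / 2) = - (y \<bullet> y) / 2"
      by (simp add: inner_vec_def power2_eq_square sum_negf flip: sum_divide_distrib)
    finally show ?thesis
      using \<open>\<bar>det T\<bar> = sqrt (det \<Omega>)\<close> \<open>det \<Omega> > 0\<close>
      by (simp add: d_def quad real_sqrt_mult real_sqrt_power power_divide power_mult_distrib)
  qed
  have [measurable]: "d \<in> borel_measurable borel"
    unfolding d_def by measurable
  have gB: "(\<lambda>x. a \<bullet> x) -` B \<in> sets borel"
    using measurable_sets[of "\<lambda>x. a \<bullet> x" borel borel B] by simp
  have hB: "(\<lambda>x. ennreal (d x) * indicator B (a \<bullet> x)) \<in> borel_measurable borel"
    by measurable
  have hT: "(\<lambda>y. ennreal (d (T *v y)) * indicator B (a \<bullet> (T *v y))) \<in> borel_measurable lborel"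
    by measurable
  have mv: "mv_normal 0 \<Omega> = density lborel (\<lambda>x. ennreal (d x))"
    by (simp only: mv_normal_def d_def)
  have "emeasure (distr (mv_normal 0 \<Omega>) borel (\<lambda>x. a \<bullet> x)) B = emeasure (mv_normal 0 \<Omega>) ((\<lambda>x. a \<bullet> x) -` B)"
    unfolding mv by (subst emeasure_distr) simp_all
  also have "\<dots> = (\<integral>\<^sup>+x. ennreal (d x) * indicator ((\<lambda>x. a \<bullet> x) -` B) x \<partial>lborel)"
    unfolding mv by (rule emeasure_density) (use gB in simp_all)
  also have "\<dots> = (\<integral>\<^sup>+x. ennreal (d x) * indicator B (a \<bullet> x) \<partial>lborel)"
    by (simp only: indicator_vimage)
  also have "\<dots> = ennreal \<bar>det T\<bar> * (\<integral>\<^sup>+y. ennreal (d (T *v y)) * indicator B (a \<bullet> (T *v y)) \<partial>lborel)"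
    by (rule nn_integral_linear_substitution[OF nzT hB])
  also have "\<dots> = (\<integral>\<^sup>+y. ennreal \<bar>det T\<bar> * (ennreal (d (T *v y)) * indicator B (a \<bullet> (T *v y))) \<partial>lborel)"
    by (rule nn_integral_cmult[symmetric, OF hT])
  also have "\<dots> = (\<integral>\<^sup>+y. ennreal (\<Prod>i\<in>UNIV. std_normal_density (y $ i)) * indicator B (y $ k) \<partial>lborel)"
    unfolding coord by (simp only: dens[symmetric] ennreal_mult'[OF abs_ge_zero] mult.assoc)
  also have "\<dots> = emeasure std_normal_distribution B"
    by (rule nn_integral_std_gaussian_coordinate[OF B])
  finally show "emeasure (distr (mv_normal 0 \<Omega>) borel (\<lambda>x. a \<bullet> x)) B = emeasure std_normal_distribution B" .
qed simp

lemma sets_mv_normal [simp, measurable_cong]: "sets (mv_normal m \<Omega>) = sets borel"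
  by (simp add: mv_normal_def)

text \<open>A measure has the same total mass as its image under a linear functional.\<close>

lemma prob_space_mv_normal:
  fixes \<Omega> :: "real^'k^'k"
  assumes "positive_definite \<Omega>"
  shows "prob_space (mv_normal 0 \<Omega>)"
proof -
  obtain k :: 'k where True by blast
  define q where "q = axis k 1 \<bullet> (\<Omega> *v axis k (1::real))"
  have "q > 0"
    using assms by (simp add: positive_definite_def q_def axis_eq_0_iff)
  then have "((1 / sqrt q) *\<^sub>R axis k 1) \<bullet> (\<Omega> *v ((1 / sqrt q) *\<^sub>R axis k 1)) = 1"
    by (simp add: matrix_vector_mult_scaleR flip: q_def)
  from distr_mv_normal_linear_functional[OF assms this]
  have "prob_space (distr (mv_normal 0 \<Omega>) borel (\<lambda>x. ((1 / sqrt q) *\<^sub>R axis k 1) \<bullet> x))"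
    by (simp add: prob_space_normal_density)
  then show ?thesis
    by (rule prob_space_distrD[rotated]) measurable
qed

section \<open>Continuous mapping and the delta method\<close>

lemma converges_in_probability_continuous_map:
  fixes X :: "nat \<Rightarrow> 'w \<Rightarrow> 'b::metric_space" and f :: "'b \<Rightarrow> 'c::metric_space"
  assumes prob: "\<And>g. prob_space (P g)" and X: "converges_in_probability P X x"
    and f: "f \<in> borel_measurable borel" and cont: "isCont f x"
  shows "converges_in_probability P (\<lambda>g \<omega>. f (X g \<omega>)) (f x)"
  unfolding converges_in_probability_def
proof (intro conjI allI impI)
  have Xm: "X g \<in> borel_measurable (P g)" for g
    using X by (simp add: converges_in_probability_def)
  show "(\<lambda>\<omega>. f (X g \<omega>)) \<in> borel_measurable (P g)" for g
    using measurable_compose[OF Xm f] .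
  fix \<epsilon> :: real assume "\<epsilon> > 0"
  then obtain \<delta> where \<delta>: "\<delta> > 0" "\<And>y. dist y x < \<delta> \<Longrightarrow> dist (f y) (f x) < \<epsilon>"
    using cont unfolding continuous_at_eps_delta by blast
  have lim: "(\<lambda>g. measure (P g) {\<omega> \<in> space (P g). dist (X g \<omega>) x > \<delta> / 2}) \<longlonglongrightarrow> 0"
    using X half_gt_zero[OF \<delta>(1)] unfolding converges_in_probability_def by blast
  show "(\<lambda>g. measure (P g) {\<omega> \<in> space (P g). dist (f (X g \<omega>)) (f x) > \<epsilon>}) \<longlonglongrightarrow> 0"
  proof (rule tendsto_sandwich[OF _ _ tendsto_const lim])
    show "\<forall>\<^sub>F g in sequentially. measure (P g) {\<omega> \<in> space (P g). dist (f (X g \<omega>)) (f x) > \<epsilon>}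
        \<le> measure (P g) {\<omega> \<in> space (P g). dist (X g \<omega>) x > \<delta> / 2}"
    proof (intro always_eventually allI)
      fix g
      interpret prob_space "P g" by (rule prob)
      have "(\<lambda>\<omega>. dist (X g \<omega>) x) \<in> borel_measurable (P g)"
        by (rule borel_measurable_continuous_on[OF _ Xm]) (intro continuous_intros)
      then have "{\<omega> \<in> space (P g). dist (X g \<omega>) x > \<delta> / 2} \<in> sets (P g)"
        by measurable
      moreover have "dist (X g \<omega>) x > \<delta> / 2" if "dist (f (X g \<omega>)) (f x) > \<epsilon>" for \<omega>
        using \<delta>(2)[of "X g \<omega>"] that \<delta>(1) by (cases "dist (X g \<omega>) x < \<delta>") auto
      ultimately show "measure (P g) {\<omega> \<in> space (P g). dist (f (X g \<omega>)) (f x) > \<epsilon>}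
          \<le> measure (P g) {\<omega> \<in> space (P g). dist (X g \<omega>) x > \<delta> / 2}"
        by (intro finite_measure_mono) auto
    qed
  qed simp
qed

lemma cts_step_bounds: "u < v \<Longrightarrow> 0 \<le> cts_step u v t" "u < v \<Longrightarrow> cts_step u v t \<le> 1"
  by (auto simp: cts_step_def field_simps)

text \<open>A single probability measure is tight. Tightness is expressed by the bounded continuous function
  \<open>min 1 (norm z / K)\<close> because weak convergence applies to it directly.\<close>

lemma tight_min_norm:
  fixes N :: "'a::euclidean_space measure"
  assumes "prob_space N" "sets N = sets borel" "\<epsilon> > 0"
  obtains K where "K > 0" "(\<integral>z. min 1 (norm z / K) \<partial>N) < \<epsilon>"
proof -
  interpret prob_space N by fact
  note [measurable_cong] = assms(2)
  have "(\<lambda>n. \<integral>z. min 1 (norm z / real (Suc n)) \<partial>N) \<longlonglongrightarrow> (\<integral>z. 0 \<partial>N)"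
  proof (rule integral_dominated_convergence[where w = "\<lambda>_. 1"])
    have "(\<lambda>n. min 1 (norm z * inverse (real (Suc n)))) \<longlonglongrightarrow> min 1 (norm z * 0)" for z :: 'a
      by (intro tendsto_intros LIMSEQ_inverse_real_of_nat)
    then show "AE z in N. (\<lambda>n. min 1 (norm z / real (Suc n))) \<longlonglongrightarrow> 0"
      by (simp add: divide_inverse)
  qed auto
  then have "\<forall>\<^sub>F n in sequentially. (\<integral>z. min 1 (norm z / real (Suc n)) \<partial>N) < \<epsilon>"
    using assms(3) by (intro order_tendstoD) auto
  then obtain n where "(\<integral>z. min 1 (norm z / real (Suc n)) \<partial>N) < \<epsilon>"
    using eventually_happens'[OF sequentially_bot] by blast
  then show thesis by (intro that[of "real (Suc n)"]) auto
qed

text \<open>With \<open>Z = r (X - x)\<close> and \<open>W = r (f X - f x)\<close>, differentiability gives \<open>\<bar>W - D Z\<bar> \<le> \<eta> \<bar>Z\<bar>\<close> unless \<open>\<bar>Z\<bar>\<close> is of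
  the order of \<open>r\<close>. For a uniformly continuous test function \<open>h\<close> with values between 0 and 1 this yields
  \<open>\<bar>h W - h (D Z)\<bar> \<le> \<epsilon> + min 1 (\<bar>Z\<bar> / K)\<close> for large \<open>r\<close>: the second term covers the event \<open>\<bar>Z\<bar> \<ge> K\<close>, and its
  expectation is small by the convergence of \<open>Z\<close>. Piecewise linear steps suffice as test functions \<open>h\<close>.\<close>

theorem delta_method:
  fixes X :: "nat \<Rightarrow> 'w \<Rightarrow> 'a::euclidean_space" and f :: "'a \<Rightarrow> real"
  assumes prob: "\<And>g. prob_space (P g)" and X [measurable]: "\<And>g. X g \<in> borel_measurable (P g)"
    and r: "filterlim r at_top sequentially"
    and f [measurable]: "f \<in> borel_measurable borel" and D: "(f has_derivative D) (at x)"
    and N: "prob_space N" "sets N = sets borel"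
    and conv: "converges_in_distribution P (\<lambda>g \<omega>. r g *\<^sub>R (X g \<omega> - x)) N"
  shows "weak_conv_m (\<lambda>g. distr (P g) borel (\<lambda>\<omega>. r g * (f (X g \<omega>) - f x))) (distr N borel D)"
proof -
  define Z where "Z g \<omega> = r g *\<^sub>R (X g \<omega> - x)" for g \<omega>
  define W where "W g \<omega> = r g * (f (X g \<omega>) - f x)" for g \<omega>
  have linD: "bounded_linear D" by (rule has_derivative_bounded_linear[OF D])
  have contD: "continuous_on UNIV D" by (rule linear_continuous_on[OF linD])
  have [measurable]: "D \<in> borel_measurable borel" by (rule borel_measurable_continuous_onI[OF contD])
  have [measurable]: "Z g \<in> borel_measurable (P g)" "W g \<in> borel_measurable (P g)" for g
    unfolding Z_def[abs_def] W_def[abs_def] by measurable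
  note [measurable_cong] = N(2)
  interpret N: prob_space N by (rule N(1))
  have convZ: "(\<lambda>g. \<integral>\<omega>. h (Z g \<omega>) \<partial>P g) \<longlonglongrightarrow> (\<integral>z. h z \<partial>N)"
    if "continuous_on UNIV h" "bounded (range h)" for h :: "'a \<Rightarrow> real"
    using conv that unfolding converges_in_distribution_def Z_def by blast
  have "weak_conv_m (\<lambda>g. distr (P g) borel (W g)) (distr N borel D)"
  proof (rule integral_cts_step_conv_imp_weak_conv)
    show "real_distribution (distr (P g) borel (W g))" for g
      by (rule prob_space.real_distribution_distr[OF prob]) measurable
    show "real_distribution (distr N borel D)"
      by (rule N.real_distribution_distr) measurable
    fix u v :: real assume uv: "u < v"
    define h where "h = cts_step u v"
    have uc: "uniformly_continuous_on UNIV h"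
      unfolding h_def by (rule cts_step_uniformly_continuous[OF uv])
    then have conth: "continuous_on UNIV h" by (rule uniformly_continuous_imp_continuous)
    have [measurable]: "h \<in> borel_measurable borel" by (rule borel_measurable_continuous_onI[OF conth])
    have h01: "0 \<le> h t" "h t \<le> 1" for t
      unfolding h_def by (rule cts_step_bounds[OF uv])+
    have "(\<lambda>g. (\<integral>\<omega>. h (W g \<omega>) \<partial>P g) - (\<integral>\<omega>. h (D (Z g \<omega>)) \<partial>P g)) \<longlonglongrightarrow> 0"
    proof (rule tendstoI)
      fix e :: real assume "e > 0"
      define \<epsilon> where "\<epsilon> = e / 2"
      have \<epsilon>: "\<epsilon> > 0" using \<open>e > 0\<close> by (simp add: \<epsilon>_def)
      obtain \<delta> where \<delta>: "\<delta> > 0" "\<And>s t. dist s t < \<delta> \<Longrightarrow> dist (h s) (h t) < \<epsilon>"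
        using uc \<epsilon> unfolding uniformly_continuous_on_def by (metis UNIV_I)
      obtain K where K: "K > 0" "(\<integral>z. min 1 (norm z / K) \<partial>N) < \<epsilon>"
        using tight_min_norm[OF N \<epsilon>] .
      \<comment> \<open>Makes the linearisation error \<open>\<eta> K\<close> on the event \<open>\<bar>Z\<bar> < K\<close> smaller than \<open>\<delta>\<close>.\<close>
      define \<eta> where "\<eta> = \<delta> / (2 * K)"
      have "\<eta> > 0" using \<delta>(1) K(1) by (simp add: \<eta>_def)
      with D obtain d where d: "d > 0" "\<And>y. norm (y - x) < d \<Longrightarrow> norm (f y - f x - D (y - x)) \<le> \<eta> * norm (y - x)"
        unfolding has_derivative_at_alt by blast
      have bnd: "\<bar>h (W g \<omega>) - h (D (Z g \<omega>))\<bar> \<le> \<epsilon> + min 1 (norm (Z g \<omega>) / K)"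
        if rg: "r g > K / d" for g \<omega>
      proof (cases "norm (Z g \<omega>) < K")
        case True
        have rpos: "r g > 0" using rg K(1) d(1) by (meson divide_pos_pos less_trans)
        have nZ: "norm (Z g \<omega>) = r g * norm (X g \<omega> - x)"
          using rpos by (simp add: Z_def)
        have "K < r g * d"
          using rg d(1) by (simp add: pos_divide_less_eq)
        with True nZ have "r g * norm (X g \<omega> - x) < r g * d" by simp
        then have "norm (X g \<omega> - x) < d" using rpos by simp
        note * = d(2)[OF this]
        have "W g \<omega> - D (Z g \<omega>) = r g * (f (X g \<omega>) - f x - D (X g \<omega> - x))"
          by (simp add: W_def Z_def linear_cmul[OF bounded_linear.linear[OF linD]] right_diff_distrib)
        then have "\<bar>W g \<omega> - D (Z g \<omega>)\<bar> \<le> r g * (\<eta> * norm (X g \<omega> - x))"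
          using * rpos by (simp add: abs_mult)
        also have "\<dots> = \<eta> * norm (Z g \<omega>)" by (simp add: nZ)
        also have "\<dots> \<le> \<eta> * K" using True \<open>\<eta> > 0\<close> by simp
        also have "\<dots> < \<delta>" using \<delta>(1) K(1) by (simp add: \<eta>_def)
        finally have "dist (h (W g \<omega>)) (h (D (Z g \<omega>))) < \<epsilon>"
          by (intro \<delta>(2)) (simp add: dist_real_def)
        moreover have "0 \<le> min 1 (norm (Z g \<omega>) / K)" using K(1) by simp
        ultimately show ?thesis by (simp add: dist_real_def)
      next
        case False
        then have "min 1 (norm (Z g \<omega>) / K) = 1" using K(1) by (simp add: min_def)
        then show ?thesis
          using h01[of "W g \<omega>"] h01[of "D (Z g \<omega>)"] \<epsilon> by (simp add: abs_le_iff)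
      qed
      have "(\<lambda>g. \<integral>\<omega>. min 1 (norm (Z g \<omega>) / K) \<partial>P g) \<longlonglongrightarrow> (\<integral>z. min 1 (norm z / K) \<partial>N)"
        using K(1) by (intro convZ continuous_intros) (auto intro!: boundedI[where B = 1])
      then have "\<forall>\<^sub>F g in sequentially. (\<integral>\<omega>. min 1 (norm (Z g \<omega>) / K) \<partial>P g) < \<epsilon>"
        by (rule order_tendstoD) (rule K(2))
      moreover have "\<forall>\<^sub>F g in sequentially. r g > K / d"
        using r by (simp add: filterlim_at_top_dense)
      ultimately show "\<forall>\<^sub>F g in sequentially. dist ((\<integral>\<omega>. h (W g \<omega>) \<partial>P g) - (\<integral>\<omega>. h (D (Z g \<omega>)) \<partial>P g)) 0 < e"
      proof eventually_elim
        case (elim g)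
        interpret prob_space "P g" by (rule prob)
        have int: "integrable (P g) (\<lambda>\<omega>. h (W g \<omega>))" "integrable (P g) (\<lambda>\<omega>. h (D (Z g \<omega>)))"
          using h01 by (auto intro!: integrable_const_bound[where B = 1])
        have intK: "integrable (P g) (\<lambda>\<omega>. min 1 (norm (Z g \<omega>) / K))"
          using K(1) by (intro integrable_const_bound[where B = 1]) auto
        have "\<bar>(\<integral>\<omega>. h (W g \<omega>) \<partial>P g) - (\<integral>\<omega>. h (D (Z g \<omega>)) \<partial>P g)\<bar>
            = \<bar>\<integral>\<omega>. h (W g \<omega>) - h (D (Z g \<omega>)) \<partial>P g\<bar>"
          using int by simp
        also have "\<dots> \<le> (\<integral>\<omega>. \<bar>h (W g \<omega>) - h (D (Z g \<omega>))\<bar> \<partial>P g)"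
          by (rule integral_abs_bound)
        also have "\<dots> \<le> (\<integral>\<omega>. \<epsilon> + min 1 (norm (Z g \<omega>) / K) \<partial>P g)"
          using int intK bnd[OF elim(2)] by (intro integral_mono) auto
        also have "\<dots> = \<epsilon> + (\<integral>\<omega>. min 1 (norm (Z g \<omega>) / K) \<partial>P g)"
          using intK by (simp add: prob_space)
        also have "\<dots> < e" using elim(1) by (simp add: \<epsilon>_def)
        finally show ?case by (simp add: dist_real_def)
      qed
    qed
    moreover have "(\<lambda>g. \<integral>\<omega>. h (D (Z g \<omega>)) \<partial>P g) \<longlonglongrightarrow> (\<integral>z. h (D z) \<partial>N)"
    proof (rule convZ)
      show "continuous_on UNIV (\<lambda>z. h (D z))"
        by (rule continuous_on_compose2[OF conth contD]) simp
      show "bounded (range (\<lambda>z. h (D z)))"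
        by (rule boundedI[where B = 1]) (use h01 in auto)
    qed
    ultimately have "(\<lambda>g. \<integral>\<omega>. h (W g \<omega>) \<partial>P g) \<longlonglongrightarrow> (\<integral>z. h (D z) \<partial>N)"
      using tendsto_add by fastforce
    then show "(\<lambda>g. \<integral>t. cts_step u v t \<partial>distr (P g) borel (W g)) \<longlonglongrightarrow> (\<integral>t. cts_step u v t \<partial>distr N borel D)"
      by (simp add: integral_distr flip: h_def)
  qed
  then show ?thesis by (simp add: W_def[abs_def])
qed

section \<open>The row \<open>B_1j\<close> as a derivative\<close>

definition unvectorise :: "'a^('n \<times> 'm) \<Rightarrow> 'a^'n^'m" where
  "unvectorise z = (\<chi> i j. z $ (j, i))"

lemma unvectorise_vectorise [simp]: "unvectorise (vectorise A) = A"
  by (simp add: unvectorise_def vectorise_def vec_eq_iff)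

lemma bounded_linear_vectorise: "bounded_linear (vectorise :: real^'n^'m \<Rightarrow> _)"
  by (rule linear_conv_bounded_linear[THEN iffD1], rule linearI) (simp_all add: vectorise_def vec_eq_iff)

lemma bounded_linear_unvectorise: "bounded_linear (unvectorise :: _ \<Rightarrow> real^'n^'m)"
  by (rule linear_conv_bounded_linear[THEN iffD1], rule linearI) (simp_all add: unvectorise_def vec_eq_iff)

lemma kron_mult_vectorise:
  fixes X :: "real^'n^'m"
  shows "kron C A *v vectorise X = vectorise (A ** X ** transpose C)"
proof -
  have "(\<Sum>q\<in>UNIV. C $ c $ fst q * A $ e $ snd q * X $ snd q $ fst q)
      = (\<Sum>n\<in>UNIV. (\<Sum>m\<in>UNIV. A $ e $ m * X $ m $ n) * C $ c $ n)" for c e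
  proof -
    have "(\<Sum>q\<in>UNIV. C $ c $ fst q * A $ e $ snd q * X $ snd q $ fst q)
        = (\<Sum>n\<in>UNIV. \<Sum>m\<in>UNIV. C $ c $ n * A $ e $ m * X $ m $ n)"
      by (simp add: sum.cartesian_product case_prod_unfold flip: UNIV_Times_UNIV)
    then show ?thesis
      by (simp add: sum_distrib_left mult_ac)
  qed
  then show ?thesis
    by (simp add: vec_eq_iff matrix_vector_mult_def matrix_matrix_mult_def kron_def vectorise_def transpose_def)
qed

definition LJ_transpose :: "real^('n::finite option)^('n option) \<Rightarrow> real^('n option)^'n" where
  "LJ_transpose R = transpose (J_block (transpose (matrix_inv R)))"

text \<open>The factors of \<open>B_1j\<close> are read from right to left, each by the identity
  \<open>(C \<otimes> A) vec X = vec (A X C\<^sup>T)\<close>; the scalar \<open>1 / R_I2\<close> joins \<open>R_I\<close>, which gives the centrality.\<close>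

lemma B_row_mult_vectorise:
  fixes R :: "real^('n::finite option)^('n option)"
  shows "(B_row l R \<Lambda>J j *v vectorise H) $ (1, 1)
    = (v_perp_T (I_block R) *v (J_block R *v (matrix_inv (mat l - \<Lambda>J) *v
        (LJ_transpose R *v (H *v (inverse (I_block R $ None) *s I_block R)))))) $ j"
proof -
  define RI where "RI = I_block R"
  define r where "r = inverse (RI $ None)"
  define V where "V = (rowvector (axis j 1) ** v_perp_T RI ** J_block R :: real^'n^1)"
  define Q where "Q = matrix_inv (mat l - \<Lambda>J)"
  have row: "(V *v y) $ 1 = (v_perp_T RI *v (J_block R *v y)) $ j" for y
  proof -
    have "(rowvector (axis j 1) *v z :: real^1) $ 1 = z $ j" for z :: "real^'n"
      by (simp add: rowvector_def matrix_vector_mult_def axis_def if_distrib if_distribR cong: if_cong)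
    then show ?thesis
      by (simp add: V_def flip: matrix_vector_mul_assoc)
  qed
  have entry: "(V ** Y) $ 1 $ 1 = (V *v column 1 Y) $ 1" for Y :: "real^1^'n"
    unfolding column_matrix_mult[symmetric] by (simp add: column_def)
  have scale: "Y ** mat a = (\<chi> i k. a * Y $ i $ k)" for Y :: "real^1^'m" and a
    by (simp add: matrix_matrix_mult_def transpose_def mat_def vec_eq_iff if_distrib)
  have col: "column 1 (Q ** (LJ_transpose R ** H ** transpose (rowvector RI :: real^('n option)^1))) = Q *v (LJ_transpose R *v (H *v RI))"
  proof -
    have "column 1 (transpose (rowvector RI :: real^('n option)^1)) = RI"
      by (simp add: vec_eq_iff column_def rowvector_def transpose_def)
    then show ?thesis
      by (simp only: column_matrix_mult matrix_vector_mul_assoc[symmetric])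
  qed
  have "(B_row l R \<Lambda>J j *v vectorise H) $ (1, 1)
      = (V ** (Q ** (LJ_transpose R ** H ** transpose (rowvector RI :: real^('n option)^1)) ** transpose (mat 1)) ** transpose (mat r)) $ 1 $ 1"
    by (simp add: B_row_def Let_def kron_mult_vectorise r_def[symmetric] RI_def[symmetric] V_def[symmetric]
        Q_def[symmetric] LJ_transpose_def[symmetric] vectorise_def[of "_ :: real^1^1"] flip: matrix_vector_mul_assoc)
  also have "\<dots> = r * (V *v (Q *v (LJ_transpose R *v (H *v RI)))) $ 1"
    by (simp add: scale entry flip: col)
  also have "\<dots> = (V *v (Q *v (LJ_transpose R *v (H *v (r *s RI))))) $ 1"
    by (simp add: vector_scalar_commute)
  finally show ?thesis
    by (simp add: row Q_def RI_def r_def)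
qed

context
  fixes M R :: "real^('n::finite option)^('n option)"
    and l1 :: real and \<Lambda>IJ :: "real^'n" and \<Lambda>J :: "real^'n^'n"
  assumes lead: "leading_eigenvalue M l1" and simple: "simple_eigenvalue M l1"
    and invR: "invertible R"
    and block: "matrix_inv R ** M ** R = block_triangular l1 \<Lambda>IJ \<Lambda>J"
    and RI: "I_block R $ None \<noteq> 0"
begin

lemma R_inverse_mult: "R *v (matrix_inv R *v x) = x" "matrix_inv R *v (R *v x) = x"
  using matrix_inv_mult_vector[of R x] invR by (simp_all add: invertible_det_nz)

lemma block_mult: "matrix_inv R *v (M *v x) = block_triangular l1 \<Lambda>IJ \<Lambda>J *v (matrix_inv R *v x)"
  unfolding block[symmetric] by (simp add: R_inverse_mult flip: matrix_vector_mul_assoc)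

lemma inverse_mult_I_block: "matrix_inv R *v I_block R = axis None 1"
  unfolding I_block_def matrix_vector_mult_axis[symmetric] by (rule R_inverse_mult)

lemma I_block_eigenvector: "M *v I_block R = l1 *s I_block R"
proof -
  have "matrix_inv R *v (M *v I_block R) = column None (block_triangular l1 \<Lambda>IJ \<Lambda>J)"
    by (simp only: block_mult inverse_mult_I_block matrix_vector_mult_axis)
  also have "\<dots> = l1 *s axis None 1"
    by (auto simp: vec_eq_iff column_def block_triangular_def axis_def split: option.split)
  finally have "R *v (matrix_inv R *v (M *v I_block R)) = R *v (l1 *s axis None 1)"
    by simp
  then show ?thesis
    unfolding R_inverse_mult vector_scalar_commute
    by (simp add: matrix_vector_mult_axis I_block_def)
qed

lemma is_centrality_I_block: "is_centrality M (inverse (I_block R $ None) *s I_block R)"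
  unfolding is_centrality_def
proof (intro conjI exI)
  show "M *v (inverse (I_block R $ None) *s I_block R) = l1 *s (inverse (I_block R $ None) *s I_block R)"
    by (simp add: vector_scalar_commute I_block_eigenvector vector_smult_assoc mult.commute)
qed (use lead simple RI in simp_all)

lemma in_centrality_domain: "M \<in> centrality_domain"
  using is_centrality_I_block by (auto simp: centrality_domain_def)

lemma centrality_eq: "centrality M = inverse (I_block R $ None) *s I_block R"
  by (rule centrality_eqI[OF is_centrality_I_block])

lemma LJ_mult:
  "(LJ_transpose R *v x) $ k = (matrix_inv R *v x) $ Some k"
  by (simp add: LJ_transpose_def J_block_def transpose_def[of "J_block _"] matrix_vector_mult_def)
    (simp add: transpose_def)

lemma sum_option: "(\<Sum>i\<in>UNIV. f i) = f None + (\<Sum>k\<in>UNIV. f (Some k))" for f :: "'n option \<Rightarrow> real"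
  by (simp add: UNIV_option_conv sum.reindex)

text \<open>The rows of \<open>L_J\<^sup>T\<close> are the lower rows of the inverse of \<open>R\<close>, and the lower left block of the
  triangular form is zero.\<close>

lemma LJ_intertwines:
  "LJ_transpose R *v (M *v x)
    = \<Lambda>J *v (LJ_transpose R *v x)"
proof -
  have "(block_triangular l1 \<Lambda>IJ \<Lambda>J *v z) $ Some k = (\<Lambda>J *v (\<chi> l. z $ Some l)) $ k" for z k
    by (simp add: matrix_vector_mult_def sum_option block_triangular_def)
  moreover have "(\<chi> l. (matrix_inv R *v x) $ Some l) = LJ_transpose R *v x"
    by (simp add: vec_eq_iff LJ_mult)
  ultimately show ?thesis
    by (subst vec_eq_iff) (simp only: LJ_mult block_mult simp_thms)
qed

lemma LJ_centrality: "LJ_transpose R *v centrality M = 0"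
proof -
  have "matrix_inv R *v centrality M = inverse (I_block R $ None) *s axis None 1"
    by (simp only: centrality_eq vector_scalar_commute inverse_mult_I_block)
  then show ?thesis
    by (simp add: vec_eq_iff[of "LJ_transpose R *v _"] LJ_mult axis_def)
qed

text \<open>\<open>L_J\<^sup>T\<close> removes the change \<open>u $ None\<close> of the eigenvalue, as this is multiplied by \<open>c\<close>.\<close>

lemma J_component_equation:
  assumes "bordered M *v u = b"
  shows "(mat l1 - \<Lambda>J) *v (LJ_transpose R *v (\<chi> i. if i = None then 0 else u $ i))
    = LJ_transpose R *v b"
proof -
  have "b = l1 *s (\<chi> i. if i = None then 0 else u $ i) - M *v (\<chi> i. if i = None then 0 else u $ i) + u $ None *s centrality M"
    using assms by (simp add: bordered_def replace_column_mult mat_minus_mult leading_root_eq[OF lead])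
  then show ?thesis
    by (simp only: mat_minus_mult matrix_vector_right_distrib matrix_vector_mult_diff_distrib LJ_intertwines
        vector_scalar_commute LJ_centrality) simp
qed

text \<open>The bordered system is solvable for every right-hand side \<open>b\<close>, and \<open>L_J\<^sup>T b\<close> is an arbitrary vector,
  so \<open>l - \<Lambda>_J\<close> is surjective.\<close>

lemma det_J_nonzero: "det (mat l1 - \<Lambda>J) \<noteq> 0"
proof -
  have "\<exists>y. (mat l1 - \<Lambda>J) *v y = w" for w
  proof -
    define b where "b = R *v (\<chi> q. case q of None \<Rightarrow> 0 | Some k \<Rightarrow> w $ k)"
    have b: "LJ_transpose R *v b = w"
      by (simp add: vec_eq_iff LJ_mult b_def R_inverse_mult)
    have "bordered M *v (matrix_inv (bordered M) *v b) = b"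
      by (rule matrix_inv_mult_vector[OF centrality_domainD(4)[OF in_centrality_domain]])
    from J_component_equation[OF this, unfolded b] show ?thesis by blast
  qed
  then have "surj (\<lambda>y. (mat l1 - \<Lambda>J) *v y)"
    by (metis surj_def)
  then show ?thesis
    unfolding matrix_right_invertible_surjective[symmetric] invertible_det_nz[symmetric] invertible_right_inverse .
qed

text \<open>Expand \<open>d = R_I (L_I\<^sup>T d) + R_J L_J\<^sup>T d\<close>. The first term is annihilated by \<open>\<upsilon>\<^sup>T\<close>, and on vectors with
  last entry 0 the matrix \<open>\<upsilon>\<^sup>T\<close> just drops this entry.\<close>

lemma v_perp_RJ_LJ:
  assumes "d $ None = 0"
  shows "(v_perp_T (I_block R) *v (J_block R *v (LJ_transpose R *v d))) $ j = d $ Some j"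
proof -
  have perp: "(v_perp_T (I_block R) *v x) $ j = x $ Some j - I_block R $ Some j / I_block R $ None * x $ None" for x
  proof -
    have "(\<Sum>k\<in>UNIV. (if j = k then 1 else 0) * x $ Some k) = (\<Sum>k\<in>UNIV. if k = j then x $ Some k else 0)"
      by (intro sum.cong) auto
    then show ?thesis
      by (simp add: matrix_vector_mult_def sum_option v_perp_T_def)
  qed
  have RJ: "(J_block R *v y) $ i = (\<Sum>k\<in>UNIV. R $ i $ Some k * y $ k)" for y i
    by (simp add: matrix_vector_mult_def J_block_def)
  have "(R *v (matrix_inv R *v d)) $ i = I_block R $ i * (matrix_inv R *v d) $ None
      + (J_block R *v (LJ_transpose R *v d)) $ i" for i
    by (simp add: RJ LJ_mult matrix_vector_mult_def[of R] sum_option I_block_def column_def)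
  then have "d $ i = I_block R $ i * (matrix_inv R *v d) $ None
      + (J_block R *v (LJ_transpose R *v d)) $ i" for i
    by (simp add: R_inverse_mult)
  then have eq: "J_block R *v (LJ_transpose R *v d)
      = d - (matrix_inv R *v d) $ None *s I_block R"
    by (simp add: vec_eq_iff)
  show ?thesis
    unfolding eq perp using RI assms by simp
qed

lemma B_row_eq_derivative:
  "(B_row l1 R \<Lambda>J j *v vectorise H) $ (1, 1) = (matrix_inv (bordered M) *v (H *v centrality M)) $ Some j"
proof -
  define u where "u = matrix_inv (bordered M) *v (H *v centrality M)"
  define d where "d = (\<chi> i. if i = None then 0 else u $ i)"
  have "bordered M *v u = H *v centrality M"
    unfolding u_def by (rule matrix_inv_mult_vector[OF centrality_domainD(4)[OF in_centrality_domain]])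
  from J_component_equation[OF this, folded d_def]
  have "matrix_inv (mat l1 - \<Lambda>J) *v (LJ_transpose R *v (H *v centrality M))
      = LJ_transpose R *v d"
    using matrix_inv_mult_vector(2)[OF det_J_nonzero] by metis
  then have "(B_row l1 R \<Lambda>J j *v vectorise H) $ (1, 1) = d $ Some j"
    unfolding B_row_mult_vectorise centrality_eq[symmetric] by (simp add: v_perp_RJ_LJ d_def)
  then show ?thesis by (simp add: d_def u_def)
qed

text \<open>Excludes a degenerate limit. The direction \<open>H\<close> is constructed such that the derivative of the
  eigenpair is the \<open>j\<close>-th unit vector; as \<open>c $ None = 1\<close>, a matrix with a single nonzero column suffices.\<close>

lemma B_row_nonzero: "row (1, 1) (B_row l1 R \<Lambda>J j) \<noteq> 0"
proof
  define H :: "real^('n option)^('n option)" where "H = (\<chi> i k. if k = None then (bordered M *v axis (Some j) 1) $ i else 0)"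
  have "H *v centrality M = bordered M *v axis (Some j) 1"
    by (simp add: H_def matrix_vector_mult_def vec_eq_iff sum_option centrality_domainD(3)[OF in_centrality_domain])
  then have "(B_row l1 R \<Lambda>J j *v vectorise H) $ (1, 1) = (matrix_inv (bordered M) *v (bordered M *v axis (Some j) 1)) $ Some j"
    by (simp only: B_row_eq_derivative)
  also have "\<dots> = 1"
    by (simp add: matrix_inv_mult_vector[OF centrality_domainD(4)[OF in_centrality_domain]])
  also assume "row (1, 1) (B_row l1 R \<Lambda>J j) = 0"
  then have "(B_row l1 R \<Lambda>J j *v vectorise H) $ (1, 1) = 0"
    by (simp add: matrix_vector_mult_def row_def)
  finally show False by simp
qed

end

section \<open>Asymptotic normality\<close>

lemma quadratic_form_row:
  fixes B :: "real^'k^'m"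
  shows "(B ** \<Omega> ** transpose B) $ i $ i = row i B \<bullet> (\<Omega> *v row i B)"
  unfolding matrix_mul_assoc[symmetric]
  by (simp add: matrix_matrix_mult_def matrix_vector_mult_def inner_vec_def transpose_def row_def)

text \<open>Continuous on the open domain, and constant outside it by the choice of the default value.\<close>

lemma borel_measurable_centrality:
  "(centrality :: real^('n::finite option)^('n option) \<Rightarrow> _) \<in> borel_measurable borel"
proof -
  have "continuous_on centrality_domain (centrality :: real^('n option)^('n option) \<Rightarrow> _)"
    using smooth_on_centrality C_k.simps(1) unfolding smooth_on_def by blast
  then have "(\<lambda>A :: real^('n option)^('n option). if A \<in> centrality_domain then centrality A else 0) \<in> borel_measurable borel"
    by (intro borel_measurable_continuous_on_if borel_open open_centrality_domain) auto
  moreover have "(\<lambda>A :: real^('n option)^('n option). if A \<in> centrality_domain then centrality A else 0) = centrality"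
    by (auto simp: centrality_def)
  ultimately show ?thesis by simp
qed

lemma asymptotic_normality_centrality:
  fixes M R :: "real^('n::finite option)^('n option)"
    and P :: "nat \<Rightarrow> 'w measure"
    and Mhat :: "nat \<Rightarrow> 'w \<Rightarrow> real^('n option)^('n option)"
  assumes M: "leading_eigenvalue M l1" "simple_eigenvalue M l1" "invertible R"
    "matrix_inv R ** M ** R = block_triangular l1 \<Lambda>IJ \<Lambda>J" "I_block R $ None \<noteq> 0"
    and pd: "positive_definite \<Omega>"
    and prob: "\<And>g. prob_space (P g)"
    and meas: "\<And>g. Mhat g \<in> borel_measurable (P g)"
    and conv: "converges_in_distribution P (\<lambda>g \<omega>. sqrt (real g) *\<^sub>R vectorise (Mhat g \<omega> - M)) (mv_normal 0 \<Omega>)"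
  shows "weak_conv_m (\<lambda>g. distr (P g) borel (\<lambda>\<omega>.
                (centrality (Mhat g \<omega>) $ Some j - centrality M $ Some j) /
                sqrt ((B_row l1 R \<Lambda>J j ** \<Omega> ** transpose (B_row l1 R \<Lambda>J j)) $ (1, 1) $ (1, 1) / real g)))
             std_normal_distribution"
proof -
  define b where "b = row (1, 1) (B_row l1 R \<Lambda>J j)"
  define s where "s = sqrt (b \<bullet> (\<Omega> *v b))"
  have "b \<bullet> (\<Omega> *v b) > 0"
    using pd B_row_nonzero[OF M] by (simp add: positive_definite_def b_def)
  then have s: "s > 0" "s * s = b \<bullet> (\<Omega> *v b)" by (simp_all add: s_def)
  \<comment> \<open>The standard deviation is put into the function, so that the limit law is standard normal.\<close>
  define f where "f z = centrality (unvectorise z) $ Some j / s" for z :: "real^('n option \<times> 'n option)"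
  have "M \<in> centrality_domain" by (rule in_centrality_domain[OF M])
  from bounded_linear.has_derivative[OF bounded_linear_vec_nth has_derivative_eigenpair[OF this], of "Some j"]
  have "((\<lambda>A. centrality A $ Some j) has_derivative (\<lambda>H. b \<bullet> vectorise H)) (at M)"
    using B_row_eq_derivative[OF M, of j]
    by (simp add: eigenpair_def b_def row_def matrix_vector_mul_component)
  then have "((\<lambda>A. centrality A $ Some j) has_derivative (\<lambda>H. b \<bullet> vectorise H)) (at (unvectorise (vectorise M)))"
    by simp
  from has_derivative_compose[OF bounded_linear_imp_has_derivative[OF bounded_linear_unvectorise] this]
  have "((\<lambda>z. centrality (unvectorise z) $ Some j) has_derivative (\<lambda>z. b \<bullet> z)) (at (vectorise M))"
    by (simp add: vectorise_def unvectorise_def)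
  then have "(f has_derivative (\<lambda>z. (b \<bullet> z) * (1 / s))) (at (vectorise M))"
    unfolding f_def[abs_def] divide_inverse by (auto intro: has_derivative_mult_left)
  then have D: "(f has_derivative (\<lambda>z. ((1 / s) *\<^sub>R b) \<bullet> z)) (at (vectorise M))"
    by simp
  have f: "f \<in> borel_measurable borel"
    unfolding f_def[abs_def]
    by (intro borel_measurable_divide borel_measurable_const
        measurable_compose[OF borel_measurable_continuous_onI[OF linear_continuous_on[OF bounded_linear_unvectorise]]
          measurable_compose[OF borel_measurable_centrality
            borel_measurable_continuous_onI[OF linear_continuous_on[OF bounded_linear_vec_nth]]]])
  have vm: "(\<lambda>\<omega>. vectorise (Mhat g \<omega>)) \<in> borel_measurable (P g)" for g
    using measurable_compose[OF meas borel_measurable_continuous_onI[OF linear_continuous_on[OF bounded_linear_vectorise]]] .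
  have diff: "vectorise (Mhat g \<omega> - M) = vectorise (Mhat g \<omega>) - vectorise M" for g \<omega>
    by (simp add: vectorise_def vec_eq_iff)
  have "filterlim (\<lambda>g. sqrt (real g)) at_top sequentially"
    by (intro filterlim_compose[OF sqrt_at_top] filterlim_real_sequentially)
  from delta_method[OF prob vm this f D prob_space_mv_normal[OF pd] sets_mv_normal conv[unfolded diff]]
  have wc: "weak_conv_m (\<lambda>g. distr (P g) borel (\<lambda>\<omega>. sqrt (real g) * (f (vectorise (Mhat g \<omega>)) - f (vectorise M))))
      (distr (mv_normal 0 \<Omega>) borel (\<lambda>z. ((1 / s) *\<^sub>R b) \<bullet> z))" .
  have std: "distr (mv_normal 0 \<Omega>) borel (\<lambda>z. ((1 / s) *\<^sub>R b) \<bullet> z) = std_normal_distribution"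
  proof (rule distr_mv_normal_linear_functional[OF pd])
    show "((1 / s) *\<^sub>R b) \<bullet> (\<Omega> *v ((1 / s) *\<^sub>R b)) = 1"
      using s(1) by (simp add: matrix_vector_mult_scaleR flip: s(2))
  qed
  have scaled: "sqrt (real g) * (f (vectorise A) - f (vectorise M))
      = (centrality A $ Some j - centrality M $ Some j) /
        sqrt ((B_row l1 R \<Lambda>J j ** \<Omega> ** transpose (B_row l1 R \<Lambda>J j)) $ (1, 1) $ (1, 1) / real g)" for g A
    unfolding quadratic_form_row b_def[symmetric] real_sqrt_divide s_def[symmetric]
    by (simp only: f_def unvectorise_vectorise divide_divide_eq_right diff_divide_distrib[symmetric]
        times_divide_eq_right mult.commute)
  show ?thesis
    using wc unfolding std scaled .
qed

theorem theorem9: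
  fixes M R :: "real^('n::finite option)^('n option)"
    and l1 :: real and \<Lambda>IJ :: "real^'n" and \<Lambda>J :: "real^'n^'n"
    and \<Omega> :: "real^('n option \<times> 'n option)^('n option \<times> 'n option)"
    and P :: "nat \<Rightarrow> 'w measure"
    and Mhat :: "nat \<Rightarrow> 'w \<Rightarrow> real^('n option)^('n option)"
  assumes "leading_eigenvalue M l1" and "simple_eigenvalue M l1"
    and "invertible R"
    and "matrix_inv R ** M ** R = block_triangular l1 \<Lambda>IJ \<Lambda>J"
    and "I_block R $ None \<noteq> 0"
    and "positive_definite \<Omega>"
    and "\<And>g. prob_space (P g)"
    and "\<And>g. Mhat g \<in> borel_measurable (P g)"
  shows "(open (centrality_domain :: (real^('n option)^('n option)) set) \<and>
          M \<in> centrality_domain \<and>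
          smooth_on centrality_domain (centrality :: real^('n option)^('n option) \<Rightarrow> _))
       \<and> (converges_in_probability P Mhat M \<longrightarrow>
          converges_in_probability P (\<lambda>g \<omega>. centrality (Mhat g \<omega>)) (centrality M))
       \<and> (converges_in_distribution P (\<lambda>g \<omega>. sqrt (real g) *\<^sub>R vectorise (Mhat g \<omega> - M))
            (mv_normal 0 \<Omega>) \<longrightarrow>
          (\<forall>j. weak_conv_m
             (\<lambda>g. distr (P g) borel (\<lambda>\<omega>.
                (centrality (Mhat g \<omega>) $ Some j - centrality M $ Some j) /
                sqrt ((B_row l1 R \<Lambda>J j ** \<Omega> ** transpose (B_row l1 R \<Lambda>J j)) $ (1, 1) $ (1, 1)
                        / real g)))
             std_normal_distribution))"
proof (intro conjI impI allI)
  show M: "M \<in> centrality_domain"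
    by (rule in_centrality_domain[OF assms(1-5)])
  show "open (centrality_domain :: (real^('n option)^('n option)) set)"
    by (rule open_centrality_domain)
  show "smooth_on centrality_domain (centrality :: real^('n option)^('n option) \<Rightarrow> _)"
    by (rule smooth_on_centrality)
  have "isCont centrality M"
    unfolding isCont_def tendsto_at_iff_tendsto_nhds by (rule centrality_domain_perturbation(3)[OF M])
  then show "converges_in_probability P (\<lambda>g \<omega>. centrality (Mhat g \<omega>)) (centrality M)"
    if "converges_in_probability P Mhat M"
    using converges_in_probability_continuous_map[OF assms(7) that borel_measurable_centrality] by simp
  show "weak_conv_m
             (\<lambda>g. distr (P g) borel (\<lambda>\<omega>.
                (centrality (Mhat g \<omega>) $ Some j - centrality M $ Some j) /
                sqrt ((B_row l1 R \<Lambda>J j ** \<Omega> ** transpose (B_row l1 R \<Lambda>J j)) $ (1, 1) $ (1, 1)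
                        / real g)))
             std_normal_distribution"
    if "converges_in_distribution P (\<lambda>g \<omega>. sqrt (real g) *\<^sub>R vectorise (Mhat g \<omega> - M)) (mv_normal 0 \<Omega>)" for j
    using asymptotic_normality_centrality[OF assms(1-8) that] .
qed

end
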